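(* Let $m,n\in\mathbb{N}$ with $m\geq 2$ and let $A,B\in M_n$. Then $\mathcal{K}_m(A)$ and $\mathcal{K}_m(B)$ are unitarily similar if and only if $\mathrm{tr}[p(A,A^* )]=\mathrm{tr}[p(B,B^* )]$ for every word $p(s,t)$ in two noncommuting variables $s,t$ for which $\mathrm{tr}[p(J_m(0),J_m(0)^* )]\neq 0$.
   Context: $M_n$ is the set of $n\times n$ complex matrices; $X^*$ is the conjugate transpose. For $A\in M_n$ and $m\ge 2$, the block upper triangular KMS matrix $\mathcal{K}_m(A)$ is the $mn\times mn$ matrix whose $(i,j)$ block ($n\times n$, $1\le i,j\le m$) is $A^{j-i}$ if $j>i$ and $0$ if $j\le i$. $J_m(0)$ is the $m\times m$ upper triangular nilpotent Jordan block. A word in noncommuting variables $s,t$ is an expression $p(s,t)=s^{m_1}t^{n_1}s^{m_2}t^{n_2}\cdots s^{m_k}t^{n_k}$ with nonnegative integer exponents $m_1,n_1,\ldots,m_k,n_k$. *)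

theory Defs
  imports "Jordan_Normal_Form.Jordan_Normal_Form" "Jordan_Normal_Form.Schur_Decomposition"
begin

definition mat_trace :: "'a :: comm_monoid_add mat \<Rightarrow> 'a" where
  "mat_trace A = (\<Sum>i<dim_row A. A $$ (i, i))"

definition unitary_mat :: "complex mat \<Rightarrow> bool" where
  "unitary_mat U \<longleftrightarrow> square_mat U \<and>
     mat_adjoint U * U = 1\<^sub>m (dim_row U) \<and> U * mat_adjoint U = 1\<^sub>m (dim_row U)"

definition unitarily_similar :: "complex mat \<Rightarrow> complex mat \<Rightarrow> bool" where
  "unitarily_similar X Y \<longleftrightarrow>
     (\<exists>N U. X \<in> carrier_mat N N \<and> Y \<in> carrier_mat N N \<and> U \<in> carrier_mat N N \<and>
        unitary_mat U \<and> X = mat_adjoint U * Y * U)"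

text \<open>Blocks are indexed from 0: for an \<open>n \<times> n\<close> matrix, the entry \<open>(r, c)\<close> lies in block
  \<open>(r div n, c div n)\<close>, at position \<open>(r mod n, c mod n)\<close> of that block.\<close>

definition kms_mat :: "nat \<Rightarrow> complex mat \<Rightarrow> complex mat" where
  "kms_mat m A = (let n = dim_row A in
     mat (m * n) (m * n) (\<lambda>(r, c).
       if r div n < c div n
       then (A ^\<^sub>m (c div n - r div n)) $$ (r mod n, c mod n)
       else 0))"

text \<open>The list \<open>[(m\<^sub>1, n\<^sub>1), \<dots>, (m\<^sub>k, n\<^sub>k)]\<close> stands for the word
  \<open>s^m\<^sub>1 t^n\<^sub>1 \<cdots> s^m\<^sub>k t^n\<^sub>k\<close>. Exponents may be 0, so distinct lists may denote the same word;
  in particular \<open>[]\<close> and \<open>[(0, 0)]\<close> both denote the empty word, with value the identity.\<close>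

type_synonym word2 = "(nat \<times> nat) list"

text \<open>The two matrices are meant to be square of the same size.\<close>

fun eval_word :: "word2 \<Rightarrow> complex mat \<Rightarrow> complex mat \<Rightarrow> complex mat" where
  "eval_word [] S T = 1\<^sub>m (dim_row S)"
| "eval_word ((a, b) # w) S T = S ^\<^sub>m a * T ^\<^sub>m b * eval_word w S T"

end

theory Submission
  imports Defs "HOL-Analysis.Function_Topology" "HOL-Analysis.Convex" "HOL-Analysis.Topology_Euclidean_Space"
begin

text \<open>Write \<open>J\<close> for the nilpotent Jordan block and \<open>X\<^sub>A = J \<otimes> A\<close>. The KMS matrix of \<open>A\<close> is
  \<open>X\<^sub>A + X\<^sub>A\<^sup>2 + \<dots>\<close>, so \<open>1 - X\<^sub>A\<close> and \<open>1 + K\<^sub>A\<close> are inverse to each other and a matrix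
  intertwines \<open>K\<^sub>A\<close> and \<open>K\<^sub>B\<close> iff it intertwines \<open>X\<^sub>A\<close> and \<open>X\<^sub>B\<close>. The trace of a word in
  \<open>X\<^sub>A, X\<^sub>A\<^sup>*\<close> is the trace of the word in \<open>J, J\<^sup>*\<close> times that in \<open>A, A\<^sup>*\<close>, and Specht's theorem
  applies to \<open>X\<^sub>A\<close> and \<open>X\<^sub>B\<close>.

  Specht's theorem for \<open>X, Y\<close> is proved by an extremal argument. Among the contractions \<open>T\<close> with
  \<open>T X = Y T\<close> and \<open>T X\<^sup>* = Y\<^sup>* T\<close> take one of maximal Frobenius norm. Comparing it with
  \<open>T (3 - T\<^sup>* T) / 2\<close> shows that it is a partial isometry. If it is not unitary, the traces still agree
  on the complementary corners \<open>P = 1 - T\<^sup>* T\<close> and \<open>Q = 1 - T T\<^sup>*\<close>. With orthonormal bases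
  \<open>a\<^sub>i, b\<^sub>i\<close> of the spans of the \<open>w(X, X\<^sup>*) P\<close> and \<open>w(Y, Y\<^sup>*) Q\<close> that correspond to each other,
  \<open>\<Sum> b\<^sub>i E a\<^sub>i\<^sup>*\<close> is an intertwiner, nonzero for some \<open>E\<close>, and a multiple of it can be added to \<open>T\<close>,
  contradicting maximality.\<close>

subsection \<open>Finitely supported matrices\<close>

text \<open>Finitely supported infinite matrices form a type-class ring; the \<open>N \<times> N\<close> matrices are the
  corner \<open>supp N\<close> of this ring, with unit \<open>idm N\<close>.\<close>

typedef fmat = "{f :: nat \<Rightarrow> nat \<Rightarrow> complex. \<exists>n. \<forall>i j. n \<le> i \<or> n \<le> j \<longrightarrow> f i j = 0}"
  morphisms ent Abs_fmat
  by (intro exI[of _ "\<lambda>_ _. 0"]) auto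

setup_lifting type_definition_fmat

definition supp :: "nat \<Rightarrow> fmat \<Rightarrow> bool" where
  "supp n a \<longleftrightarrow> (\<forall>i j. n \<le> i \<or> n \<le> j \<longrightarrow> ent a i j = 0)"

lemma suppD: "supp n a \<Longrightarrow> n \<le> i \<or> n \<le> j \<Longrightarrow> ent a i j = 0"
  by (auto simp: supp_def)

lemma supp_mono: "supp n a \<Longrightarrow> n \<le> k \<Longrightarrow> supp k a"
  by (auto simp: supp_def)

lemma supp_ex: "\<exists>n. supp n a"
  using ent[of a] by (auto simp: supp_def)

lemma supp_common2: obtains n where "supp n a" "supp n b"
  using supp_ex[of a] supp_ex[of b] supp_mono by (metis max.cobounded1 max.cobounded2)

lemma supp_common3: obtains n where "supp n a" "supp n b" "supp n c"
  using supp_common2[of a b] supp_ex[of c] supp_mono by (metis max.cobounded1 max.cobounded2)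

lemma fmat_eqI: "(\<And>i j. ent a i j = ent b i j) \<Longrightarrow> a = b"
  by (metis ent_inject ext)

instantiation fmat :: ring
begin

lift_definition zero_fmat :: fmat is "\<lambda>_ _. 0" by auto

lift_definition plus_fmat :: "fmat \<Rightarrow> fmat \<Rightarrow> fmat" is "\<lambda>a b i j. a i j + b i j"
proof -
  fix a b :: "nat \<Rightarrow> nat \<Rightarrow> complex"
  assume "\<exists>n. \<forall>i j. n \<le> i \<or> n \<le> j \<longrightarrow> a i j = 0" "\<exists>n. \<forall>i j. n \<le> i \<or> n \<le> j \<longrightarrow> b i j = 0"
  then obtain n k where "\<forall>i j. n \<le> i \<or> n \<le> j \<longrightarrow> a i j = 0" "\<forall>i j. k \<le> i \<or> k \<le> j \<longrightarrow> b i j = 0"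
    by blast
  then show "\<exists>n. \<forall>i j. n \<le> i \<or> n \<le> j \<longrightarrow> a i j + b i j = 0"
    by (intro exI[of _ "max n k"]) auto
qed

lift_definition uminus_fmat :: "fmat \<Rightarrow> fmat" is "\<lambda>a i j. - a i j"
  by auto

definition minus_fmat :: "fmat \<Rightarrow> fmat \<Rightarrow> fmat" where "a - b = a + (- b)" for a b :: fmat

text \<open>Finite support makes the index set \<open>a i k \<noteq> 0\<close> finite, so no size
  enters the product; \<open>ent_times\<close> rewrites the sum over any bound for the support of
  the left factor.\<close>

lift_definition times_fmat :: "fmat \<Rightarrow> fmat \<Rightarrow> fmat"
  is "\<lambda>a b i j. \<Sum>k | a i k \<noteq> 0. a i k * b k j"
proof -
  fix a b :: "nat \<Rightarrow> nat \<Rightarrow> complex"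
  assume "\<exists>n. \<forall>i j. n \<le> i \<or> n \<le> j \<longrightarrow> a i j = 0" "\<exists>n. \<forall>i j. n \<le> i \<or> n \<le> j \<longrightarrow> b i j = 0"
  then obtain n k where "\<forall>i j. n \<le> i \<or> n \<le> j \<longrightarrow> a i j = 0" "\<forall>i j. k \<le> i \<or> k \<le> j \<longrightarrow> b i j = 0"
    by blast
  then show "\<exists>n. \<forall>i j. n \<le> i \<or> n \<le> j \<longrightarrow> (\<Sum>k | a i k \<noteq> 0. a i k * b k j) = 0"
    by (intro exI[of _ "max n k"]) auto
qed

lemma ent_times: "supp n a \<Longrightarrow> ent (a * b) i j = (\<Sum>k<n. ent a i k * ent b k j)"
  unfolding times_fmat.rep_eq
  by (rule sum.mono_neutral_left) (auto simp: supp_def not_less intro: leI)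

lemma ent_plus: "ent (a + b) i j = ent a i j + ent b i j"
  by (simp add: plus_fmat.rep_eq)

lemma ent_uminus: "ent (- a) i j = - ent a i j"
  by (simp add: uminus_fmat.rep_eq)

lemma ent_zero: "ent 0 i j = 0"
  by (simp add: zero_fmat.rep_eq)

instance
proof
  fix a b c :: fmat
  show "a + b + c = a + (b + c)" "a + b = b + a" "0 + a = a" "- a + a = 0" "a - b = a + - b"
    by (auto intro!: fmat_eqI simp: ent_plus ent_uminus ent_zero minus_fmat_def)
  obtain n where n: "supp n a" "supp n b" "supp n c" by (rule supp_common3)
  then have ab: "supp n (a * b)" and pab: "supp n (a + b)"
    by (auto simp: supp_def ent_times[OF n(1)] ent_plus)
  show "a * b * c = a * (b * c)"
    by (rule fmat_eqI) (simp add: ent_times[OF n(1)] ent_times[OF n(2)] ent_times[OF ab]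
        sum_distrib_left sum_distrib_right mult.assoc, subst sum.swap, rule refl)
  show "(a + b) * c = a * c + b * c" "a * (b + c) = a * b + a * c"
    by (auto intro!: fmat_eqI simp: ent_plus ent_times[OF n(1)] ent_times[OF n(2)] ent_times[OF pab]
        algebra_simps sum.distrib)
qed

end

lemma ent_minus: "ent (a - b) i j = ent a i j - ent b i j"
  by (simp add: diff_conv_add_uminus ent_plus ent_uminus del: add_uminus_conv_diff)

lemma ent_sum: "ent (sum f A) i j = (\<Sum>x\<in>A. ent (f x) i j)"
  by (induction A rule: infinite_finite_induct) (auto simp: ent_plus ent_zero)

section \<open>Adjoint, trace and the Frobenius norm\<close>

lift_definition scl :: "complex \<Rightarrow> fmat \<Rightarrow> fmat" is "\<lambda>c a i j. c * a i j"
  by (metis mult_zero_right)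

lift_definition adj :: "fmat \<Rightarrow> fmat" is "\<lambda>a i j. cnj (a j i)"
  by (metis complex_cnj_zero)

lift_definition idm :: "nat \<Rightarrow> fmat" is "\<lambda>n i j. if i = j \<and> i < n then 1 else 0"
  by (metis not_le)

lift_definition munit :: "nat \<Rightarrow> nat \<Rightarrow> fmat" is "\<lambda>p q i j. if i = p \<and> j = q then 1 else 0"
  by (metis Suc_n_not_le_n max.cobounded1 max.cobounded2 le_trans)

definition tr :: "fmat \<Rightarrow> complex" where "tr a = (\<Sum>i | ent a i i \<noteq> 0. ent a i i)"

text \<open>The Frobenius inner product, conjugate-linear in its first argument; \<open>nrm2\<close>
  is the square of its norm.\<close>

definition ip :: "fmat \<Rightarrow> fmat \<Rightarrow> complex" where "ip a b = tr (adj a * b)"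

definition nrm2 :: "fmat \<Rightarrow> real" where "nrm2 a = Re (ip a a)"

lemmas ent_scl = scl.rep_eq
lemmas ent_adj = adj.rep_eq
lemmas ent_idm = idm.rep_eq
lemmas ent_munit = munit.rep_eq

lemma tr_supp: "supp n a \<Longrightarrow> tr a = (\<Sum>i<n. ent a i i)"
  unfolding tr_def by (rule sum.mono_neutral_left) (auto simp: supp_def intro: leI)

lemma supp_zero [simp, intro]: "supp n 0"
  and supp_plus [intro]: "supp n a \<Longrightarrow> supp n b \<Longrightarrow> supp n (a + b)"
  and supp_minus [intro]: "supp n a \<Longrightarrow> supp n b \<Longrightarrow> supp n (a - b)"
  and supp_scl [intro]: "supp n a \<Longrightarrow> supp n (scl c a)"
  and supp_adj [intro]: "supp n a \<Longrightarrow> supp n (adj a)"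
  and supp_idm [simp, intro]: "supp n (idm n)"
  and supp_times [intro]: "supp n a \<Longrightarrow> supp n b \<Longrightarrow> supp n (a * b)"
  by (auto simp: supp_def ent_plus ent_minus ent_zero ent_scl ent_adj ent_idm ent_times)

lemma supp_munit: "p < n \<Longrightarrow> q < n \<Longrightarrow> supp n (munit p q)"
  by (auto simp: supp_def ent_munit)

lemma supp_sum [intro]: "(\<And>x. x \<in> A \<Longrightarrow> supp n (f x)) \<Longrightarrow> supp n (sum f A)"
  by (simp add: supp_def ent_sum)

lemma idm_left [simp]: "supp n a \<Longrightarrow> idm n * a = a"
proof (rule fmat_eqI)
  fix i j assume a: "supp n a"
  show "ent (idm n * a) i j = ent a i j"
    using suppD[OF a, of i j]
    by (cases "i < n") (simp_all add: ent_times[OF supp_idm] ent_idm if_distrib if_distribR cong: if_cong)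
qed

lemma adj_add [simp]: "adj (a + b) = adj a + adj b"
  and adj_diff [simp]: "adj (a - b) = adj a - adj b"
  and adj_scl [simp]: "adj (scl c a) = scl (cnj c) (adj a)"
  and adj_adj [simp]: "adj (adj a) = a"
  and adj_zero [simp]: "adj 0 = 0"
  and adj_idm [simp]: "adj (idm n) = idm n"
  by (auto intro!: fmat_eqI simp: ent_adj ent_plus ent_minus ent_uminus ent_scl ent_zero ent_idm)

lemma adj_mult [simp]: "adj (a * b) = adj b * adj a"
proof -
  obtain n where n: "supp n a" "supp n b" by (rule supp_common2)
  show ?thesis
    by (rule fmat_eqI) (simp add: ent_adj ent_times[OF n(1)] ent_times[OF supp_adj[OF n(2)]] mult.commute)
qed

lemma adj_sum: "adj (sum f A) = (\<Sum>x\<in>A. adj (f x))"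
  by (rule fmat_eqI) (simp add: ent_adj ent_sum)

lemma idm_right [simp]: "supp n a \<Longrightarrow> a * idm n = a"
  by (metis adj_adj adj_idm adj_mult idm_left supp_adj)

lemma scl_0 [simp]: "scl 0 a = 0"
  and scl_minus_one: "scl (-1) a = - a"
  by (auto intro!: fmat_eqI simp: ent_scl ent_plus ent_minus ent_zero ent_uminus algebra_simps)

lemma scl_mult [simp]: "scl c a * b = scl c (a * b)" "a * scl c b = scl c (a * b)"
proof -
  obtain n where n: "supp n a" by (meson supp_ex)
  show "scl c a * b = scl c (a * b)" "a * scl c b = scl c (a * b)"
    by (auto intro!: fmat_eqI simp: ent_times[OF n] ent_times[OF supp_scl[OF n]] ent_scl
        sum_distrib_left mult_ac)
qed

lemma tr_add [simp]: "tr (a + b) = tr a + tr b"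
  by (rule supp_common2[of a b]) (simp add: tr_supp[OF supp_plus] tr_supp ent_plus sum.distrib)

lemma tr_scl [simp]: "tr (scl c a) = c * tr a"
  using supp_ex[of a] by (auto simp: tr_supp[OF supp_scl] tr_supp ent_scl sum_distrib_left)

lemma tr_zero [simp]: "tr 0 = 0"
  by (simp add: tr_def ent_zero)

lemma tr_minus [simp]: "tr (- a) = - tr a"
  using tr_scl[of "-1" a] by (simp add: scl_minus_one)

lemma tr_diff [simp]: "tr (a - b) = tr a - tr b"
  by (simp add: diff_conv_add_uminus del: add_uminus_conv_diff)

lemma tr_sum: "tr (sum f A) = (\<Sum>x\<in>A. tr (f x))"
  by (induction A rule: infinite_finite_induct) auto

lemma tr_adj [simp]: "tr (adj a) = cnj (tr a)"
  using supp_ex[of a] by (auto simp: tr_supp[OF supp_adj] tr_supp ent_adj)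

lemma tr_commute: "tr (a * b) = tr (b * a)"
proof -
  obtain n where n: "supp n a" "supp n b" by (rule supp_common2)
  show ?thesis
    unfolding tr_supp[OF supp_times[OF n]] tr_supp[OF supp_times[OF n(2) n(1)]]
      ent_times[OF n(1)] ent_times[OF n(2)]
    by (subst sum.swap) (simp add: mult.commute)
qed

lemma ip_supp: "supp n a \<Longrightarrow> ip a b = (\<Sum>i<n. \<Sum>j<n. cnj (ent a i j) * ent b i j)"
proof -
  assume a: "supp n a"
  obtain k where k: "supp k a" "supp k b" by (rule supp_common2)
  have kn: "supp (max n k) a" "supp (max n k) b" using k supp_mono by auto
  have "ip a b = (\<Sum>j<max n k. \<Sum>i<max n k. cnj (ent a i j) * ent b i j)"
    unfolding ip_def tr_supp[OF supp_times[OF supp_adj[OF kn(1)] kn(2)]]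
      ent_times[OF supp_adj[OF kn(1)]] by (simp add: ent_adj)
  also have "\<dots> = (\<Sum>i<max n k. \<Sum>j<max n k. cnj (ent a i j) * ent b i j)"
    by (rule sum.swap)
  also have "\<dots> = (\<Sum>i<n. \<Sum>j<max n k. cnj (ent a i j) * ent b i j)"
    by (rule sum.mono_neutral_right) (auto simp: suppD[OF a])
  also have "\<dots> = (\<Sum>i<n. \<Sum>j<n. cnj (ent a i j) * ent b i j)"
    by (rule sum.cong[OF refl], rule sum.mono_neutral_right) (auto simp: suppD[OF a])
  finally show ?thesis .
qed

lemma ip_add_left: "ip (a + b) c = ip a c + ip b c"
  and ip_add_right: "ip a (b + c) = ip a b + ip a c"
  and ip_diff_left: "ip (a - b) c = ip a c - ip b c"
  and ip_diff_right: "ip a (b - c) = ip a b - ip a c"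
  and ip_scl_left: "ip (scl k a) b = cnj k * ip a b"
  and ip_scl_right: "ip a (scl k b) = k * ip a b"
  and ip_zero_left [simp]: "ip 0 b = 0"
  and ip_zero_right [simp]: "ip a 0 = 0"
  by (simp_all add: ip_def algebra_simps)

lemma ip_sum_right: "ip a (sum f A) = (\<Sum>x\<in>A. ip a (f x))"
  by (simp add: ip_def sum_distrib_left tr_sum)

lemma ip_cnj: "ip b a = cnj (ip a b)"
  by (metis adj_adj adj_mult ip_def tr_adj)

lemma ip_mult_left: "ip (a * b) c = ip b (adj a * c)"
  and ip_mult_right: "ip a (b * c) = ip (adj b * a) c"
  by (simp_all add: ip_def mult.assoc)

lemma nrm2_supp: "supp n a \<Longrightarrow> nrm2 a = (\<Sum>i<n. \<Sum>j<n. (cmod (ent a i j))\<^sup>2)"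
  unfolding nrm2_def by (simp add: ip_supp cmod_def power2_eq_square)

lemma ip_self: "ip a a = of_real (nrm2 a)"
  by (metis nrm2_def ip_cnj Reals_cnj_iff of_real_Re)

lemma nrm2_ge_0 [simp]: "nrm2 a \<ge> 0"
  using supp_ex[of a] by (auto simp: nrm2_supp intro!: sum_nonneg)

lemma nrm2_eq_0_iff [simp]: "nrm2 a = 0 \<longleftrightarrow> a = 0"
proof
  assume 0: "nrm2 a = 0"
  obtain n where n: "supp n a" by (meson supp_ex)
  have "ent a i j = 0" if "i < n" "j < n" for i j
    using 0 that unfolding nrm2_supp[OF n]
    by (subst (asm) sum_nonneg_eq_0_iff) (auto intro!: sum_nonneg simp: sum_nonneg_eq_0_iff)
  then show "a = 0" using suppD[OF n] by (intro fmat_eqI) (metis ent_zero not_le)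
qed (simp add: nrm2_def)

lemma nrm2_zero [simp]: "nrm2 0 = 0" by simp

lemma nrm2_pos: "a \<noteq> 0 \<Longrightarrow> nrm2 a > 0"
  by (metis nrm2_ge_0 nrm2_eq_0_iff order_less_le)

lemma nrm2_scl: "nrm2 (scl c a) = (cmod c)\<^sup>2 * nrm2 a"
  by (simp add: nrm2_def ip_scl_left ip_scl_right cmod_def power2_eq_square algebra_simps)

lemma nrm2_adj: "nrm2 (adj a) = nrm2 a"
  by (simp add: nrm2_def ip_def tr_commute)

lemma nrm2_add: "nrm2 (a + b) = nrm2 a + 2 * Re (ip a b) + nrm2 b"
  using ip_cnj[of b a] by (simp add: nrm2_def ip_add_left ip_add_right)

lemma nrm2_diff: "nrm2 (a - b) = nrm2 a - 2 * Re (ip a b) + nrm2 b"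
  using ip_cnj[of b a] by (simp add: nrm2_def ip_diff_left ip_diff_right)

text \<open>Cauchy-Schwarz in each entry of the product, then summation. It shows that a matrix of
  Frobenius norm 1 is a contraction.\<close>

lemma nrm2_mult_le: "nrm2 (a * b) \<le> nrm2 a * nrm2 b"
proof -
  obtain n where n: "supp n a" "supp n b" by (rule supp_common2)
  have "(cmod (ent (a * b) i j))\<^sup>2 \<le> (\<Sum>k<n. (cmod (ent a i k))\<^sup>2) * (\<Sum>k<n. (cmod (ent b k j))\<^sup>2)" for i j
  proof -
    have "cmod (ent (a * b) i j) \<le> (\<Sum>k<n. cmod (ent a i k) * cmod (ent b k j))"
      unfolding ent_times[OF n(1)] by (rule order_trans[OF norm_sum]) (simp add: norm_mult)
    then have "(cmod (ent (a * b) i j))\<^sup>2 \<le> (\<Sum>k<n. cmod (ent a i k) * cmod (ent b k j))\<^sup>2"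
      by (simp add: power_mono)
    also have "\<dots> \<le> (\<Sum>k<n. (cmod (ent a i k))\<^sup>2) * (\<Sum>k<n. (cmod (ent b k j))\<^sup>2)"
      by (rule Cauchy_Schwarz_ineq_sum)
    finally show ?thesis .
  qed
  then have "nrm2 (a * b) \<le> (\<Sum>i<n. \<Sum>j<n. (\<Sum>k<n. (cmod (ent a i k))\<^sup>2) * (\<Sum>k<n. (cmod (ent b k j))\<^sup>2))"
    unfolding nrm2_supp[OF supp_times[OF n]] by (intro sum_mono)
  also have "\<dots> = nrm2 a * (\<Sum>j<n. \<Sum>k<n. (cmod (ent b k j))\<^sup>2)"
    unfolding nrm2_supp[OF n(1)] by (simp add: sum_product)
  also have "(\<Sum>j<n. \<Sum>k<n. (cmod (ent b k j))\<^sup>2) = nrm2 b"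
    unfolding nrm2_supp[OF n(2)] by (rule sum.swap)
  finally show ?thesis .
qed


subsection \<open>Orthonormal bases and compactness\<close>

text \<open>Here \<open>s\<close> is the orthogonal projection of \<open>v\<close> onto the span of
  the \<open>e i\<close>; expanding \<open>nrm2 (v - s) \<ge> 0\<close> gives the
  inequality.\<close>

lemma bessel:
  fixes n :: nat
  assumes "\<And>i j. i < n \<Longrightarrow> j < n \<Longrightarrow> ip (e i) (e j) = (if i = j then 1 else 0)"
  shows "(\<Sum>i<n. (cmod (ip (e i) v))\<^sup>2) \<le> nrm2 v"
proof -
  define s where "s = (\<Sum>i<n. scl (ip (e i) v) (e i))"
  have es: "ip (e j) s = ip (e j) v" if "j < n" for j
  proof -
    have "ip (e j) s = (\<Sum>i<n. if i = j then ip (e i) v else 0)"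
      unfolding s_def ip_sum_right ip_scl_right using assms that by (intro sum.cong) auto
    then show ?thesis using that by simp
  qed
  have xs: "ip x s = (\<Sum>i<n. ip (e i) v * cnj (ip (e i) x))" for x
    by (simp add: s_def ip_sum_right ip_scl_right ip_cnj[of x])
  have "ip v s = (\<Sum>i<n. of_real ((cmod (ip (e i) v))\<^sup>2))"
    "ip s s = (\<Sum>i<n. of_real ((cmod (ip (e i) v))\<^sup>2))"
    unfolding xs[of v] xs[of s] by (intro sum.cong; simp add: es complex_norm_square del: of_real_power)+
  then have "Re (ip v s) = (\<Sum>i<n. (cmod (ip (e i) v))\<^sup>2)" "nrm2 s = (\<Sum>i<n. (cmod (ip (e i) v))\<^sup>2)"
    by (simp_all add: nrm2_def)
  then show ?thesis
    using nrm2_ge_0[of "v - s"] unfolding nrm2_diff by linarith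
qed

lemma ip_munit: "ip a (munit p q) = cnj (ent a p q)"
proof -
  obtain n0 where "supp n0 a" by (meson supp_ex)
  then have a: "supp (Suc (max n0 (max p q))) a" (is "supp ?n a") by (rule supp_mono) simp
  have "ip a (munit p q) = (\<Sum>i<?n. \<Sum>j<?n. if j = q then if i = p then cnj (ent a i j) else 0 else 0)"
    unfolding ip_supp[OF a] by (intro sum.cong refl) (simp add: ent_munit)
  also have "\<dots> = (\<Sum>i<?n. if i = p then cnj (ent a i q) else 0)"
    by (intro sum.cong refl) (subst sum.delta, auto)
  also have "\<dots> = cnj (ent a p q)"
    by (subst sum.delta) auto
  finally show ?thesis .
qed

lemma nrm2_munit: "nrm2 (munit p q) = 1"
  by (simp add: nrm2_def ip_munit ent_munit)

text \<open>A dimension bound by double counting: the squared norms of the \<open>e i\<close> add up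
  to \<open>n\<close>, while summing Bessel's inequality over the \<open>N * N\<close> unit matrices
  bounds the same double sum.\<close>

lemma orthonormal_card_le:
  fixes n :: nat
  assumes on: "\<And>i j. i < n \<Longrightarrow> j < n \<Longrightarrow> ip (e i) (e j) = (if i = j then 1 else 0)"
    and supp: "\<And>i. i < n \<Longrightarrow> supp N (e i)"
  shows "n \<le> N * N"
proof -
  have "real n = (\<Sum>i<n. nrm2 (e i))"
    using on by (simp add: nrm2_def)
  also have "\<dots> = (\<Sum>i<n. \<Sum>p<N. \<Sum>q<N. (cmod (ip (e i) (munit p q)))\<^sup>2)"
    by (intro sum.cong refl) (simp add: nrm2_supp[OF supp] ip_munit)
  also have "\<dots> = (\<Sum>p<N. \<Sum>i<n. \<Sum>q<N. (cmod (ip (e i) (munit p q)))\<^sup>2)"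
    by (rule sum.swap)
  also have "\<dots> = (\<Sum>p<N. \<Sum>q<N. \<Sum>i<n. (cmod (ip (e i) (munit p q)))\<^sup>2)"
    by (rule sum.cong[OF refl], rule sum.swap)
  also have "\<dots> \<le> (\<Sum>p<N. \<Sum>q<N. 1)"
    using bessel[OF on] nrm2_munit by (intro sum_mono) metis
  finally show ?thesis
    by (simp flip: of_nat_mult)
qed

text \<open>The relation \<open>R\<close> is linear and preserves inner products, so it is the graph
  of an isometry. A longest orthonormal family inside \<open>R\<close> exists by the dimension
  bound, and maximality makes it span.\<close>

lemma orthonormal_basis_pairs:
  fixes R :: "fmat \<Rightarrow> fmat \<Rightarrow> bool"
  assumes supp: "\<And>a b. R a b \<Longrightarrow> supp N a"
    and zero: "R 0 0"
    and add: "\<And>a b a' b'. R a b \<Longrightarrow> R a' b' \<Longrightarrow> R (a + a') (b + b')"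
    and scl: "\<And>a b c. R a b \<Longrightarrow> R (scl c a) (scl c b)"
    and ip: "\<And>a b a' b'. R a b \<Longrightarrow> R a' b' \<Longrightarrow> ip a a' = ip b b'"
  obtains n :: nat and e f where
    "\<And>i. i < n \<Longrightarrow> R (e i) (f i)"
    "\<And>i j. i < n \<Longrightarrow> j < n \<Longrightarrow> ip (e i) (e j) = (if i = j then 1 else 0)"
    "\<And>a b. R a b \<Longrightarrow> a = (\<Sum>i<n. scl (ip (e i) a) (e i))"
    "\<And>a b. R a b \<Longrightarrow> b = (\<Sum>i<n. scl (ip (e i) a) (f i))"
proof -
  define ons where "ons n e f \<longleftrightarrow> (\<forall>i<n. R (e i) (f i)) \<and>
    (\<forall>i<n. \<forall>j<n. ip (e i) (e j) = (if i = j then 1 else 0))" for n :: nat and e f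
  have sum: "R (sum g {..<k}) (sum h {..<k})" if "\<And>i. i < k \<Longrightarrow> R (g i) (h i)" for g h and k :: nat
    using that by (induction k) (auto simp: zero add)
  have bd: "n \<le> N * N" if "ons n e f" for n e f
    using that supp unfolding ons_def by (intro orthonormal_card_le[of n e]) blast+
  have "\<exists>n. (\<exists>e f. ons n e f) \<and> (\<forall>k. (\<exists>e f. ons k e f) \<longrightarrow> k \<le> n)"
  proof (rule Nat.ex_has_greatest_nat[of _ 0])
    show "\<exists>e f. ons 0 e f" by (simp add: ons_def)
  qed (use bd in blast)
  then obtain n e f where n: "ons n e f" and max: "\<And>k e' f'. ons k e' f' \<Longrightarrow> k \<le> n"
    by blast
  have R: "\<And>i. i < n \<Longrightarrow> R (e i) (f i)"
    and on: "\<And>i j. i < n \<Longrightarrow> j < n \<Longrightarrow> ip (e i) (e j) = (if i = j then 1 else 0)"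
    using n by (auto simp: ons_def)
  have "a = (\<Sum>i<n. scl (ip (e i) a) (e i)) \<and> b = (\<Sum>i<n. scl (ip (e i) a) (f i))" if ab: "R a b" for a b
  proof -
    define r where "r = a + scl (-1) (\<Sum>i<n. scl (ip (e i) a) (e i))"
    define r' where "r' = b + scl (-1) (\<Sum>i<n. scl (ip (e i) a) (f i))"
    have rr: "R r r'"
      unfolding r_def r'_def by (intro add scl sum ab R)
    have orth: "ip (e j) r = 0" if "j < n" for j
    proof -
      have "(\<Sum>i<n. ip (e j) (scl (ip (e i) a) (e i))) = (\<Sum>i<n. if i = j then ip (e i) a else 0)"
        unfolding ip_scl_right using on that by (intro sum.cong) auto
      then show ?thesis
        using that by (simp add: r_def ip_add_right ip_scl_right[of _ "-1"] ip_sum_right)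
    qed
    have "r = 0"
    proof (rule ccontr)
      assume "r \<noteq> 0"
      then have pos: "nrm2 r > 0" by (rule nrm2_pos)
      \<comment> \<open>The remainder \<open>r\<close> is orthogonal to all \<open>e j\<close>;
        normalised, it would extend the longest family.\<close>
      define c :: complex where "c = of_real (1 / sqrt (nrm2 r))"
      have "cnj c * c * of_real (nrm2 r) = 1"
        using pos \<open>r \<noteq> 0\<close> unfolding c_def by (simp flip: of_real_mult)
      then have "ons (Suc n) (e(n := scl c r)) (f(n := scl c r'))"
        using R on orth ip_cnj[of r] rr scl
        by (auto simp: ons_def less_Suc_eq ip_scl_left ip_scl_right ip_self mult_ac)
      then show False using max by fastforce
    qed
    \<comment> \<open>The partner of a zero remainder has norm 0, because \<open>R\<close> preserves
      inner products.\<close>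
    moreover from this have "r' = 0"
      using ip[OF rr rr] by (metis ip_zero_left nrm2_def nrm2_eq_0_iff zero_complex.sel(1))
    ultimately show ?thesis
      by (simp add: r_def r'_def scl_minus_one)
  qed
  then show ?thesis using R on by (intro that[of n e f]) blast+
qed

text \<open>Parametrises the corner \<open>supp N\<close> by functions on index pairs, so that
  closedness, continuity and compactness refer to the product topology on these functions.\<close>

lift_definition trunc :: "nat \<Rightarrow> (nat \<times> nat \<Rightarrow> complex) \<Rightarrow> fmat"
  is "\<lambda>N f i j. if i < N \<and> j < N then f (i, j) else 0"
  by (metis not_le)

lemmas ent_trunc = trunc.rep_eq

lemma supp_trunc [simp, intro]: "supp N (trunc N f)"
  by (auto simp: supp_def ent_trunc)

lemma trunc_ent: "supp N a \<Longrightarrow> trunc N (\<lambda>(i, j). ent a i j) = a"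
  by (intro fmat_eqI) (auto simp: ent_trunc supp_def not_less)

lemma continuous_on_trunc [continuous_intros]: "continuous_on UNIV (\<lambda>f. ent (trunc N f) i j)"
  by (cases "i < N \<and> j < N") (auto simp: ent_trunc)

lemma continuous_on_trunc_mult [continuous_intros]: "continuous_on UNIV (\<lambda>f. ent (trunc N f * a) i j)"
  unfolding ent_times[OF supp_trunc] by (intro continuous_intros)

lemma continuous_on_mult_trunc [continuous_intros]: "continuous_on UNIV (\<lambda>f. ent (a * trunc N f) i j)"
proof -
  obtain n where n: "supp n a" by (meson supp_ex)
  show ?thesis unfolding ent_times[OF n] by (intro continuous_intros)
qed

text \<open>The norm bound confines every entry to a closed disc, a product of such discs is compact
  by Tychonoff, and \<open>nrm2\<close> is continuous in the entries.\<close>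

lemma nrm2_attains_max:
  assumes "C \<noteq> {}" and supp: "\<And>T. T \<in> C \<Longrightarrow> supp N T" and bd: "\<And>T. T \<in> C \<Longrightarrow> nrm2 T \<le> c"
    and closed: "closed {f. trunc N f \<in> C}"
  obtains T where "T \<in> C" "\<And>S. S \<in> C \<Longrightarrow> nrm2 S \<le> nrm2 T"
proof -
  \<comment> \<open>One disc for every index pair, also outside the \<open>N \<times> N\<close>
    corner, where \<open>trunc\<close> ignores the coordinate.\<close>
  define B where "B = (\<lambda>_ :: nat \<times> nat. cball (0 :: complex) (sqrt c))"
  define F where "F T = (\<lambda>(i, j). ent T i j)" for T
  have "compact (PiE UNIV B)"
    using compactin_PiE[of "\<lambda>_. euclidean" UNIV B]
    by (simp add: euclidean_product_topology compactin_euclidean_iff B_def)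
  then have K: "compact (PiE UNIV B \<inter> {f. trunc N f \<in> C})"
    using closed by (rule compact_Int_closed)
  have FB: "F T \<in> PiE UNIV B \<inter> {f. trunc N f \<in> C}" if T: "T \<in> C" for T
  proof -
    have "cmod (ent T i j) \<le> sqrt c" for i j
    proof (cases "i < N \<and> j < N")
      case True
      have "(cmod (ent T i j))\<^sup>2 \<le> (\<Sum>l<N. (cmod (ent T i l))\<^sup>2)"
        using True by (intro member_le_sum) auto
      also have "\<dots> \<le> nrm2 T"
        unfolding nrm2_supp[OF supp[OF T]]
        using True by (intro member_le_sum[where f="\<lambda>i. \<Sum>l<N. (cmod (ent T i l))\<^sup>2"]) (auto intro: sum_nonneg)
      finally have "(cmod (ent T i j))\<^sup>2 \<le> c" using bd[OF T] by simp
      then show ?thesis by (rule real_le_rsqrt)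
    next
      case False
      then have "ent T i j = 0" using suppD[OF supp[OF T]] by (metis not_le)
      moreover have "0 \<le> c" using bd[OF T] nrm2_ge_0 order_trans by blast
      ultimately show ?thesis by simp
    qed
    then show ?thesis using T trunc_ent[OF supp[OF T]] by (auto simp: F_def B_def)
  qed
  have "continuous_on (PiE UNIV B \<inter> {f. trunc N f \<in> C}) (\<lambda>f. nrm2 (trunc N f))"
    unfolding nrm2_supp[OF supp_trunc]
    by (rule continuous_on_subset[of UNIV]) (auto intro!: continuous_intros)
  moreover have "PiE UNIV B \<inter> {f. trunc N f \<in> C} \<noteq> {}"
    using assms(1) FB by blast
  ultimately obtain f where f: "trunc N f \<in> C"
    and max: "\<And>g. g \<in> PiE UNIV B \<inter> {f. trunc N f \<in> C} \<Longrightarrow> nrm2 (trunc N g) \<le> nrm2 (trunc N f)"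
    using continuous_attains_sup[OF K] by (metis (no_types, lifting) IntD2 mem_Collect_eq)
  show ?thesis
  proof (rule that[OF f])
    fix S assume "S \<in> C"
    then show "nrm2 S \<le> nrm2 (trunc N f)"
      using max[OF FB[of S]] trunc_ent[OF supp] by (simp add: F_def)
  qed
qed


subsection \<open>Specht's theorem\<close>

text \<open>The graph of the map \<open>w(X, X\<^sup>*) \<mapsto> w(Y, Y\<^sup>*)\<close> between the two generated \<open>*\<close>-algebras.\<close>

inductive walg :: "nat \<Rightarrow> fmat \<Rightarrow> fmat \<Rightarrow> fmat \<Rightarrow> fmat \<Rightarrow> bool" for N X Y where
  one: "walg N X Y (idm N) (idm N)"
| mult: "walg N X Y a b \<Longrightarrow> walg N X Y (X * a) (Y * b)"
| mult_adj: "walg N X Y a b \<Longrightarrow> walg N X Y (adj X * a) (adj Y * b)"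
| add: "walg N X Y a b \<Longrightarrow> walg N X Y c d \<Longrightarrow> walg N X Y (a + c) (b + d)"
| scl: "walg N X Y a b \<Longrightarrow> walg N X Y (scl k a) (scl k b)"

lemma walg_supp:
  assumes "walg N X Y a b" "supp N X" "supp N Y"
  shows "supp N a" "supp N b"
  using assms by (induction) auto

lemma walg_times:
  assumes "walg N X Y a b" "walg N X Y c d" "supp N X" "supp N Y"
  shows "walg N X Y (a * c) (b * d)"
  using assms(1)
proof induction
  case one
  then show ?case using assms walg_supp by (metis idm_left)
qed (auto simp: mult.assoc distrib_right intro: walg.intros)

lemma walg_adj:
  assumes "walg N X Y a b" "supp N X" "supp N Y"
  shows "walg N X Y (adj a) (adj b)"
  using assms(1)
proof induction
  case one
  then show ?case by (simp add: walg.one)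
next
  case (mult a b)
  \<comment> \<open>The rules of \<open>walg\<close> multiply on the left only; as
    \<open>adj X * idm N\<close> the new factor is itself an element, and \<open>walg_times\<close>
    can place it on the right.\<close>
  have "walg N X Y (adj a * (adj X * idm N)) (adj b * (adj Y * idm N))"
    using assms mult.IH by (intro walg_times walg.intros)
  then show ?case using assms by (simp add: supp_adj)
next
  case (mult_adj a b)
  have "walg N X Y (adj a * (X * idm N)) (adj b * (Y * idm N))"
    using assms mult_adj.IH by (intro walg_times walg.intros)
  then show ?case using assms by (simp add: supp_adj)
qed (auto intro: walg.intros)

lemma walg_intertwine:
  assumes "walg N X Y a b" "supp N T" "T * X = Y * T" "T * adj X = adj Y * T"
  shows "T * a = b * T"
  using assms(1)
proof induction
  case (mult a b)
  then show ?case by (metis assms(3) mult.assoc)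
next
  case (mult_adj a b)
  then show ?case by (metis assms(4) mult.assoc)
qed (use assms in \<open>auto simp: distrib_left distrib_right\<close>)

lemma walg_commute:
  assumes "walg N X Y a b"
  shows "supp N P \<Longrightarrow> P * X = X * P \<Longrightarrow> P * adj X = adj X * P \<Longrightarrow> P * a = a * P"
    and "supp N Q \<Longrightarrow> Q * Y = Y * Q \<Longrightarrow> Q * adj Y = adj Y * Q \<Longrightarrow> Q * b = b * Q"
proof -
  \<comment> \<open>Pairing each component with itself makes commutation a special case of
    intertwining.\<close>
  have "walg N X X a a" "walg N Y Y b b"
    using assms by induction (auto intro: walg.intros)
  then show "supp N P \<Longrightarrow> P * X = X * P \<Longrightarrow> P * adj X = adj X * P \<Longrightarrow> P * a = a * P"
    and "supp N Q \<Longrightarrow> Q * Y = Y * Q \<Longrightarrow> Q * adj Y = adj Y * Q \<Longrightarrow> Q * b = b * Q"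
    using walg_intertwine by blast+
qed

section \<open>Intertwiners built from corresponding orthonormal bases\<close>

lemma ent_mult_munit_mult: "ent (a * munit k l * b) p q = ent a p k * ent b l q"
proof -
  obtain n0 where "supp n0 a" by (meson supp_ex)
  then have a: "supp (Suc (max n0 (max k l))) a" (is "supp ?n a") by (rule supp_mono) simp
  have u: "supp ?n (munit k l)" by (rule supp_munit) auto
  have "ent (a * munit k l) p j = (if j = l then ent a p k else 0)" for j
  proof -
    have "ent (a * munit k l) p j = (\<Sum>i<?n. if i = k then (if j = l then ent a p k else 0) else 0)"
      unfolding ent_times[OF a] by (intro sum.cong) (auto simp: ent_munit)
    then show ?thesis by (subst (asm) sum.delta) auto
  qed
  then have "ent (a * munit k l * b) p q = (\<Sum>j<?n. if j = l then ent a p k * ent b l q else 0)"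
    unfolding ent_times[OF supp_times[OF a u]] by (intro sum.cong) auto
  then show ?thesis by (subst (asm) sum.delta) auto
qed

text \<open>Left multiplication by \<open>X\<close> on the \<open>e i\<close> and by
  \<open>Y\<close> on the \<open>f i\<close> have the same coefficient matrix. Invariance under
  \<open>adj X\<close> lets \<open>X\<close> pass through \<open>adj (e j)\<close> with the
  transposed coefficients, so both sides become the same double sum.\<close>

lemma sum_intertwines:
  fixes n :: nat
  assumes X: "\<And>i. i < n \<Longrightarrow> X * e i = (\<Sum>j<n. scl (ip (e j) (X * e i)) (e j))"
    and Y: "\<And>i. i < n \<Longrightarrow> Y * f i = (\<Sum>j<n. scl (ip (e j) (X * e i)) (f j))"
    and X': "\<And>i. i < n \<Longrightarrow> adj X * e i = (\<Sum>j<n. scl (ip (e j) (adj X * e i)) (e j))"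
  shows "(\<Sum>i<n. f i * E * adj (e i)) * X = Y * (\<Sum>i<n. f i * E * adj (e i))"
proof -
  have eX: "adj (e j) * X = (\<Sum>i<n. scl (ip (e j) (X * e i)) (adj (e i)))" if "j < n" for j
  proof -
    have "adj (e j) * X = adj (adj X * e j)" by simp
    also have "\<dots> = (\<Sum>i<n. scl (cnj (ip (e i) (adj X * e j))) (adj (e i)))"
      by (subst X'[OF that]) (simp add: adj_sum)
    also have "\<dots> = (\<Sum>i<n. scl (ip (e j) (X * e i)) (adj (e i)))"
      by (metis (no_types, lifting) ip_mult_left ip_cnj)
    finally show ?thesis .
  qed
  have "(\<Sum>i<n. f i * E * adj (e i)) * X = (\<Sum>j<n. f j * E * (adj (e j) * X))"
    by (simp add: sum_distrib_right mult.assoc)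
  also have "\<dots> = (\<Sum>j<n. \<Sum>i<n. scl (ip (e j) (X * e i)) (f j * E * adj (e i)))"
    by (intro sum.cong) (auto simp: eX sum_distrib_left)
  also have "\<dots> = (\<Sum>i<n. \<Sum>j<n. scl (ip (e j) (X * e i)) (f j * E * adj (e i)))"
    by (rule sum.swap)
  also have "\<dots> = (\<Sum>i<n. Y * f i * (E * adj (e i)))"
    by (intro sum.cong) (auto simp: Y sum_distrib_right mult.assoc)
  also have "\<dots> = Y * (\<Sum>i<n. f i * E * adj (e i))"
    by (simp add: sum_distrib_left mult.assoc)
  finally show ?thesis .
qed

text \<open>The trace condition makes \<open>u * P \<mapsto> v * Q\<close> an isometry
  \<open>R\<close> compatible with \<open>X\<close>, \<open>Y\<close> and their adjoints.
  Corresponding bases of its domain and range then yield the intertwiners \<open>S k l\<close>,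
  which cannot all vanish.\<close>

lemma nonzero_intertwiner:
  assumes X: "supp N X" and Y: "supp N Y"
    and P: "supp N P" "adj P = P" "P * P = P" "P * X = X * P" "P * adj X = adj X * P"
    and Q: "supp N Q" "adj Q = Q" "Q * Q = Q" "Q * Y = Y * Q" "Q * adj Y = adj Y * Q"
    and trace: "\<And>a b. walg N X Y a b \<Longrightarrow> tr (a * P) = tr (b * Q)"
    and "P \<noteq> 0"
  obtains S where "supp N S" "S \<noteq> 0" "S * P = S" "Q * S = S" "S * X = Y * S" "S * adj X = adj Y * S"
proof -
  define R where "R a b \<longleftrightarrow> (\<exists>u v. walg N X Y u v \<and> a = u * P \<and> b = v * Q)" for a b
  note comm = walg_commute(1)[OF _ P(1,4,5)] walg_commute(2)[OF _ Q(1,4,5)]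
  have R_X: "R (X * a) (Y * b)" "R (adj X * a) (adj Y * b)" if "R a b" for a b
    using that unfolding R_def by (metis walg.mult walg.mult_adj mult.assoc)+
  have R_supp: "supp N a" "supp N b" if "R a b" for a b
    using that walg_supp X Y P Q by (auto simp: R_def)
  have R_corner: "P * a = a" "Q * b = b" if ab: "R a b" for a b
  proof -
    obtain u v where uv: "walg N X Y u v" "a = u * P" "b = v * Q"
      using ab by (auto simp: R_def)
    show "P * a = a" "Q * b = b"
      using comm[OF uv(1)] uv P Q by (metis mult.assoc)+
  qed
  have R_ip: "ip a a' = ip b b'" if ab: "R a b" "R a' b'" for a b a' b'
  proof -
    obtain u v u' v' where uv: "walg N X Y u v" "a = u * P" "b = v * Q"
      "walg N X Y u' v'" "a' = u' * P" "b' = v' * Q"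
      using ab by (auto simp: R_def)
    \<comment> \<open>The product has a projection at both ends; cyclicity and
      \<open>P * P = P\<close> remove one, which leaves the form covered by
      \<open>trace\<close>.\<close>
    have "ip a a' = tr (P * (adj u * u' * P))"
      using uv P by (simp add: ip_def mult.assoc)
    also have "\<dots> = tr (adj u * u' * P)"
      using P by (subst tr_commute) (simp add: mult.assoc)
    also have "\<dots> = tr (adj v * v' * Q)"
      using uv X Y by (intro trace walg_times walg_adj)
    also have "\<dots> = tr (Q * (adj v * v' * Q))"
      using Q by (subst (2) tr_commute) (simp add: mult.assoc)
    also have "\<dots> = ip b b'"
      using uv Q by (simp add: ip_def mult.assoc)
    finally show ?thesis .
  qed
  have R_zero: "R 0 0"
    using walg.scl[OF walg.one, of N X Y 0] by (auto simp: R_def intro!: exI[of _ 0])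
  have R_add: "R (a + a') (b + b')" if ab: "R a b" "R a' b'" for a b a' b'
  proof -
    obtain u v u' v' where "walg N X Y u v" "a = u * P" "b = v * Q"
      "walg N X Y u' v'" "a' = u' * P" "b' = v' * Q"
      using ab by (auto simp: R_def)
    then show ?thesis
      unfolding R_def by (intro exI[of _ "u + u'"] exI[of _ "v + v'"]) (simp add: walg.add distrib_right)
  qed
  have R_scl: "R (scl c a) (scl c b)" if "R a b" for a b c
    using that unfolding R_def by (metis walg.scl scl_mult(1))
  obtain n :: nat and e f where ef: "\<And>i. i < n \<Longrightarrow> R (e i) (f i)"
    and on: "\<And>i j. i < n \<Longrightarrow> j < n \<Longrightarrow> ip (e i) (e j) = (if i = j then 1 else 0)"
    and span: "\<And>a b. R a b \<Longrightarrow> a = (\<Sum>i<n. scl (ip (e i) a) (e i))"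
    and span': "\<And>a b. R a b \<Longrightarrow> b = (\<Sum>i<n. scl (ip (e i) a) (f i))"
    by (rule orthonormal_basis_pairs[of R N, OF R_supp(1) R_zero R_add R_scl R_ip]) blast+
  define S where "S k l = (\<Sum>i<n. f i * munit k l * adj (e i))" for k l
  have "\<exists>k<N. \<exists>l<N. S k l \<noteq> 0"
  proof (rule ccontr)
    assume "\<not> ?thesis"
    then have 0: "S k l = 0" if "k < N" "l < N" for k l
      using that by blast
    have "ent (e j) q l = 0" if j: "j < n" and l: "l < N" for j q l
    proof -
      have S0: "(\<Sum>i<n. ent (f i) p k * cnj (ent (e i) q l)) = 0" if "k < N" for p k
      proof -
        have "ent (S k l) p q = 0" using 0[OF that l] by (simp add: ent_zero)
        then show ?thesis by (simp add: S_def ent_sum ent_mult_munit_mult ent_adj)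
      qed
      \<comment> \<open>The family \<open>f\<close> is orthonormal because \<open>R\<close>
        preserves inner products; pairing the vanishing sums \<open>S0\<close> with
        \<open>f j\<close> therefore isolates the entry of \<open>e j\<close>.\<close>
      have "cnj (ent (e j) q l) = (\<Sum>i<n. if i = j then cnj (ent (e i) q l) else 0)"
        using j by simp
      also have "\<dots> = (\<Sum>i<n. ip (f j) (f i) * cnj (ent (e i) q l))"
        using on R_ip ef j by (intro sum.cong) (auto simp flip: R_ip[OF ef ef])
      also have "\<dots> = (\<Sum>i<n. \<Sum>p<N. \<Sum>k<N. cnj (ent (f j) p k) * (ent (f i) p k * cnj (ent (e i) q l)))"
        unfolding ip_supp[OF R_supp(2)[OF ef[OF j]]] by (simp add: sum_distrib_right mult.assoc)
      also have "\<dots> = (\<Sum>p<N. \<Sum>k<N. \<Sum>i<n. cnj (ent (f j) p k) * (ent (f i) p k * cnj (ent (e i) q l)))"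
        by (subst sum.swap, rule sum.cong[OF refl], rule sum.swap)
      also have "\<dots> = (\<Sum>p<N. \<Sum>k<N. cnj (ent (f j) p k) * (\<Sum>i<n. ent (f i) p k * cnj (ent (e i) q l)))"
        by (simp add: sum_distrib_left)
      also have "\<dots> = 0" using S0 by simp
      finally show ?thesis by simp
    qed
    then have "e j = 0" if "j < n" for j
      using that suppD[OF R_supp(1)[OF ef[OF that]]] by (intro fmat_eqI) (metis ent_zero not_le)
    then have "n = 0"
      using on[of 0 0] by (metis gr0I ip_zero_left zero_neq_one)
    \<comment> \<open>With \<open>n = 0\<close> every element of the domain of \<open>R\<close> is
      an empty sum, yet \<open>P\<close> belongs to it.\<close>
    moreover have "R P Q"
      unfolding R_def using P Q by (intro exI[of _ "idm N"]) (simp add: walg.one)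
    ultimately show False using span[of P Q] \<open>P \<noteq> 0\<close> by simp
  qed
  then obtain k l where kl: "k < N" "l < N" and nz: "S k l \<noteq> 0" by blast
  show ?thesis
  proof (rule that[OF _ nz])
    show "supp N (S k l)"
      unfolding S_def using R_supp(1)[OF ef] R_supp(2)[OF ef] kl
      by (intro supp_sum supp_times supp_adj supp_munit) auto
    have "adj (e i) * P = adj (e i)" if "i < n" for i
      using R_corner(1)[OF ef[OF that]] P by (metis adj_mult)
    then show "S k l * P = S k l"
      by (simp add: S_def sum_distrib_right mult.assoc)
    show "Q * S k l = S k l"
      by (simp add: S_def sum_distrib_left R_corner(2)[OF ef] flip: mult.assoc)
    show "S k l * X = Y * S k l"
      unfolding S_def
      by (rule sum_intertwines) (use span[OF R_X(1)[OF ef]] span'[OF R_X(1)[OF ef]] span[OF R_X(2)[OF ef]] in blast)+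
    show "S k l * adj X = adj Y * S k l"
      unfolding S_def
      \<comment> \<open>The same lemma for \<open>adj X\<close> and \<open>adj Y\<close>; its
        hypothesis on the adjoint becomes one on \<open>X\<close>.\<close>
      by (rule sum_intertwines; (unfold adj_adj)?)
        (use span[OF R_X(2)[OF ef]] span'[OF R_X(2)[OF ef]] span[OF R_X(1)[OF ef]] in blast)+
  qed
qed

lemma intertwine_comp:
  fixes S T X Y Z :: fmat
  shows "T * X = Y * T \<Longrightarrow> S * Y = Z * S \<Longrightarrow> S * T * X = Z * (S * T)"
  by (metis mult.assoc)


text \<open>Maximality of \<open>T\<close> is tested on two competitors: \<open>T2\<close> forces
  \<open>T * H = T\<close>, and \<open>T + S'\<close> forces \<open>P = 0\<close>. Equality of the
  traces of \<open>P\<close> and \<open>Q\<close> then gives \<open>Q = 0\<close>.\<close>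

theorem unitary_intertwiner:
  assumes X: "supp N X" and Y: "supp N Y"
    and trace: "\<And>a b. walg N X Y a b \<Longrightarrow> tr a = tr b"
  obtains U where "supp N U" "adj U * U = idm N" "U * adj U = idm N" "U * X = Y * U"
proof -
  \<comment> \<open>Contractivity is stated with matrices \<open>z\<close> in place of vectors; this
    is the same operator norm bound, and \<open>z = idm N\<close> turns it into a Frobenius
    bound.\<close>
  define C where "C = {T. supp N T \<and> T * X = Y * T \<and> T * adj X = adj Y * T \<and>
    (\<forall>z. supp N z \<longrightarrow> nrm2 (T * z) \<le> nrm2 z)}"
  have ne: "C \<noteq> {}" by (auto simp: C_def intro!: exI[of _ 0])
  have supp: "supp N T" if "T \<in> C" for T
    using that by (simp add: C_def)
  have bd: "nrm2 T \<le> nrm2 (idm N)" if "T \<in> C" for T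
    using that by (auto simp: C_def dest!: spec[of _ "idm N"])
  have closed: "closed {f. trunc N f \<in> C}"
  proof -
    have eq: "closed {f. trunc N f * a = b * trunc N f}" for a b
    proof -
      have "{f. trunc N f * a = b * trunc N f} =
          {f. \<forall>i j. ent (trunc N f * a) i j = ent (b * trunc N f) i j}"
        by (auto intro: fmat_eqI)
      also have "closed \<dots>"
        by (intro closed_Collect_all closed_Collect_eq continuous_intros)
      finally show ?thesis .
    qed
    have "closed {f. supp N z \<longrightarrow> nrm2 (trunc N f * z) \<le> nrm2 z}" for z
    proof (cases "supp N z")
      case True
      then show ?thesis
        by (simp add: nrm2_supp[OF supp_times[OF supp_trunc]] del: of_nat_sum)
          (intro closed_Collect_le continuous_intros)
    qed simp
    then show ?thesis
      unfolding C_def mem_Collect_eq using eq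
      by (intro closed_Collect_conj closed_Collect_all) auto
  qed
  obtain T where "T \<in> C" and max: "\<And>S. S \<in> C \<Longrightarrow> nrm2 S \<le> nrm2 T"
    by (rule nrm2_attains_max[OF ne supp bd closed]) (assumption, assumption, rule that)
  from \<open>T \<in> C\<close> have T: "supp N T" "T * X = Y * T" "T * adj X = adj Y * T"
    and contr: "\<And>z. supp N z \<Longrightarrow> nrm2 (T * z) \<le> nrm2 z"
    by (auto simp: C_def)
  have T': "adj T * Y = X * adj T" "adj T * adj Y = adj X * adj T"
    using T by (metis adj_mult adj_adj)+
  define H where "H = adj T * T"
  have H: "supp N H" "H * X = X * H" "H * adj X = adj X * H" "adj H = H"
    unfolding H_def using T T' by (auto intro: intertwine_comp)
  define D where "D = T - T * H"
  \<comment> \<open>\<open>T2 = T (3 - H) / 2\<close>: the function \<open>s (3 - s\<^sup>2) / 2\<close> maps \<open>[0, 1]\<close> into itself, lies above \<open>s\<close>, and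
    has the fixed points 0 and 1 only, so maximality forces the singular values of \<open>T\<close> to be 0 or 1.\<close>
  define T2 where "T2 = T + scl (1 / 2) D"
  have "T2 \<in> C"
  proof -
    have "supp N D" "D * X = Y * D" "D * adj X = adj Y * D"
      unfolding D_def using T intertwine_comp[OF H(2) T(2)] intertwine_comp[OF H(3) T(3)] H(1)
      by (simp_all add: left_diff_distrib right_diff_distrib supp_minus supp_times)
    then have "supp N T2" "T2 * X = Y * T2" "T2 * adj X = adj Y * T2"
      unfolding T2_def distrib_left distrib_right using T by (simp_all add: supp_plus supp_scl)
    moreover have "nrm2 (T2 * z) \<le> nrm2 z" if z: "supp N z" for z
    proof -
      \<comment> \<open>Since \<open>H * z = z - u\<close>, the squared norm of
        \<open>T2 * z\<close> becomes \<open>nrm2 z - nrm2 u + nrm2 (T * u) / 4\<close>, and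
        \<open>T\<close> contracts \<open>u\<close>.\<close>
      define u where "u = z - H * z"
      have u: "supp N u" using H z by (auto simp: u_def)
      have "T2 * z = T * z + scl (1 / 2) (T * u)"
        by (simp add: T2_def D_def u_def algebra_simps)
      then have "nrm2 (T2 * z) = nrm2 (T * z) + Re (ip (T * z) (T * u)) + nrm2 (T * u) / 4"
        by (simp add: nrm2_add nrm2_scl ip_scl_right power2_eq_square)
      moreover have "ip (T * z) (T * u) = ip (z - u) u"
        by (simp add: ip_mult_right H_def u_def mult.assoc)
      moreover have "nrm2 (T * z) = Re (ip z (z - u))"
        by (simp add: nrm2_def ip_mult_left H_def u_def mult.assoc)
      ultimately have "nrm2 (T2 * z) = nrm2 z - nrm2 u + nrm2 (T * u) / 4"
        using ip_cnj[of z u] by (simp add: ip_diff_left ip_diff_right nrm2_def)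
      then show ?thesis using contr[OF u] nrm2_ge_0[of u] by linarith
    qed
    ultimately show ?thesis
      unfolding C_def by blast
  qed
  then have "nrm2 T2 \<le> nrm2 T" by (rule max)
  moreover have "nrm2 T2 = nrm2 T + (nrm2 (adj T) - nrm2 (T * adj T)) + nrm2 D / 4"
  proof -
    have "ip T D = ip T T - ip (T * adj T) (T * adj T)"
      unfolding D_def ip_diff_right H_def by (simp add: ip_def mult.assoc, subst (2) tr_commute, simp add: mult.assoc)
    then have "Re (ip T D) = nrm2 (adj T) - nrm2 (T * adj T)"
      by (simp add: nrm2_adj) (simp add: nrm2_def)
    then show ?thesis
      by (simp add: T2_def nrm2_add nrm2_scl ip_scl_right power2_eq_square)
  qed
  \<comment> \<open>Contractivity at \<open>z = adj T\<close> makes the bracketed difference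
    nonnegative, so maximality leaves no room for \<open>D\<close>.\<close>
  moreover have "nrm2 (T * adj T) \<le> nrm2 (adj T)" using T by (intro contr) auto
  ultimately have "nrm2 D = 0" using nrm2_ge_0[of D] by linarith
  then have TH: "T * H = T" by (simp add: D_def)
  define P where "P = idm N - H"
  define Q where "Q = idm N - T * adj T"
  have HH: "H * H = H" using TH by (simp add: H_def mult.assoc)
  have TT: "T * adj T * (T * adj T) = T * adj T" using TH by (simp add: H_def flip: mult.assoc)
  have P: "supp N P" "adj P = P" "P * P = P" "P * X = X * P" "P * adj X = adj X * P"
    using H X HH unfolding P_def by (simp_all add: left_diff_distrib right_diff_distrib supp_adj supp_minus)
  have TTY: "supp N (T * adj T)" "T * adj T * Y = Y * (T * adj T)" "T * adj T * adj Y = adj Y * (T * adj T)"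
    using T T' by (auto intro: intertwine_comp)
  have Q: "supp N Q" "adj Q = Q" "Q * Q = Q" "Q * Y = Y * Q" "Q * adj Y = adj Y * Q"
    using TTY Y TT unfolding Q_def by (simp_all add: left_diff_distrib right_diff_distrib supp_adj supp_minus)
  have "tr (a * P) = tr (b * Q)" if w: "walg N X Y a b" for a b
  proof -
    have "a * P = a - a * adj T * T" "b * Q = b - b * T * adj T"
      using walg_supp[OF w X Y] by (simp_all add: P_def Q_def H_def right_diff_distrib mult.assoc)
    \<comment> \<open>By cyclicity and \<open>T * a = b * T\<close> the two subtracted traces
      agree.\<close>
    moreover have "tr (a * adj T * T) = tr (T * a * adj T)"
      by (subst tr_commute) (simp add: mult.assoc)
    moreover have "T * a = b * T" using walg_intertwine[OF w] T by blast
    ultimately show ?thesis using trace[OF w] by simp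
  qed
  note intertwiner = nonzero_intertwiner[OF X Y P Q this]
  have "P = 0"
  proof (rule ccontr)
    assume "P \<noteq> 0"
    with intertwiner obtain S where S: "supp N S" "S \<noteq> 0" "S * P = S" "Q * S = S"
      "S * X = Y * S" "S * adj X = adj Y * S" by metis
    \<comment> \<open>Scaling to Frobenius norm 1 makes \<open>S'\<close> a contraction.\<close>
    define c :: complex where "c = of_real (1 / sqrt (nrm2 S))"
    define S' where "S' = scl c S"
    have "nrm2 S > 0" using S by (intro nrm2_pos)
    then have nS': "nrm2 S' = 1"
      using S(2) by (simp add: S'_def nrm2_scl c_def norm_divide power_divide)
    have S': "supp N S'" "S' * P = S'" "Q * S' = S'" "S' * X = Y * S'" "S' * adj X = adj Y * S'"
      using S by (auto simp: S'_def)
    \<comment> \<open>The aim is \<open>adj T * S' = 0\<close>: the range of \<open>S'\<close> lies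
      in that of \<open>Q\<close>, which is orthogonal to the range of \<open>T\<close>.\<close>
    have "H * adj T = adj T" using arg_cong[OF TH, of adj] H(4) by simp
    then have "adj T * Q = 0"
      using T(1) unfolding Q_def H_def by (simp add: right_diff_distrib supp_adj mult.assoc)
    then have TS: "adj T * S' = 0"
      using S'(3) by (metis mult.assoc mult_zero_left)
    have "T + S' \<in> C"
    proof -
      have "nrm2 ((T + S') * z) \<le> nrm2 z" if z: "supp N z" for z
      proof -
        \<comment> \<open>Pythagoras twice: \<open>T\<close> sees only \<open>H * z\<close>,
          \<open>S'\<close> sees only \<open>P * z\<close>, and both the two parts and their images
          are orthogonal.\<close>
        have zz: "z = H * z + P * z" using z by (simp add: P_def left_diff_distrib)
        have "ip (H * z) (P * z) = 0"
        proof -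
          have "P * (H * z) = 0"
            using H(1) z by (simp add: P_def left_diff_distrib supp_times HH flip: mult.assoc)
          then show ?thesis by (simp add: ip_mult_right P(2))
        qed
        then have nz: "nrm2 z = nrm2 (H * z) + nrm2 (P * z)"
          by (subst zz) (simp add: nrm2_add)
        have "ip (T * z) (S' * z) = 0"
          unfolding ip_mult_left mult.assoc[of "adj T", symmetric] TS by simp
        then have "nrm2 ((T + S') * z) = nrm2 (T * z) + nrm2 (S' * z)"
          by (simp add: distrib_right nrm2_add)
        also have "T * z = T * (H * z)" using TH by (simp flip: mult.assoc)
        also have "nrm2 \<dots> \<le> nrm2 (H * z)" using H z by (intro contr) auto
        also have "S' * z = S' * (P * z)" using S' by (simp flip: mult.assoc)
        also have "nrm2 \<dots> \<le> nrm2 (P * z)" using nrm2_mult_le[of S' "P * z"] nS' by simp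
        finally show ?thesis using nz by simp
      qed
      then show ?thesis
        unfolding C_def mem_Collect_eq distrib_left distrib_right[of T S' X] distrib_right[of T S' "adj X"]
        using T S' by (simp add: supp_plus)
    qed
    then have "nrm2 (T + S') \<le> nrm2 T" by (rule max)
    \<comment> \<open>Orthogonality gives \<open>nrm2 (T + S') = nrm2 T + 1\<close>.\<close>
    moreover have "ip T S' = 0" using TS by (simp add: ip_def)
    ultimately show False using nS' by (simp add: nrm2_add)
  qed
  \<comment> \<open>For a projection the squared Frobenius norm is the trace, and
    \<open>T * adj T\<close> has the same trace as \<open>H\<close>.\<close>
  have "nrm2 Q = Re (tr Q)" using Q by (simp add: nrm2_def ip_def)
  also have "tr Q = tr P" by (simp add: P_def Q_def H_def tr_commute)
  finally have "Q = 0" using \<open>P = 0\<close> by simp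
  then show ?thesis
    using \<open>P = 0\<close> T that by (simp add: P_def Q_def H_def)
qed


subsection \<open>Kronecker products and KMS matrices\<close>

lemma index_mult_sum:
  assumes "A \<in> carrier_mat n k" "B \<in> carrier_mat k m" "i < n" "j < m"
  shows "(A * B) $$ (i, j) = (\<Sum>l<k. A $$ (i, l) * B $$ (l, j))"
  using assms by (auto simp: scalar_prod_def atLeast0LessThan)

lemma mat_adjoint_carrier [simp]: "A \<in> carrier_mat n m \<Longrightarrow> mat_adjoint A \<in> carrier_mat m n"
  by (auto simp: mat_adjoint_def)

lemma mat_adjoint_index:
  fixes A :: "complex mat"
  assumes "A \<in> carrier_mat n m" "i < m" "j < n"
  shows "mat_adjoint A $$ (i, j) = cnj (A $$ (j, i))"
  using assms by (auto simp: mat_adjoint_def mat_of_rows_index conjugate_complex_def)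

lemma mat_trace_carrier: "A \<in> carrier_mat n n \<Longrightarrow> mat_trace A = (\<Sum>i<n. A $$ (i, i))"
  by (simp add: mat_trace_def)

lemma pow_mat_Suc_left:
  assumes "A \<in> carrier_mat n n"
  shows "A ^\<^sub>m Suc k = A * A ^\<^sub>m k"
proof (induction k)
  case (Suc k)
  then show ?case
    using assms by simp (metis assoc_mult_mat pow_carrier_mat)
qed (use assms in auto)

lemma eval_word_carrier [simp]:
  "S \<in> carrier_mat n n \<Longrightarrow> T \<in> carrier_mat n n \<Longrightarrow> eval_word p S T \<in> carrier_mat n n"
  by (induction p S T rule: eval_word.induct) (auto intro!: mult_carrier_mat[of _ n n])

text \<open>The recursion of \<open>eval_word\<close> peels factors off the left, whereas the trace
  induction in Specht's theorem extends words on the right.\<close>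

lemma eval_word_snoc:
  assumes "S \<in> carrier_mat n n" "T \<in> carrier_mat n n"
  shows "eval_word (p @ [(a, b)]) S T = eval_word p S T * (S ^\<^sub>m a * T ^\<^sub>m b)"
proof (induction p)
  case Nil
  then show ?case using assms by (simp add: right_mult_one_mat[of _ n n] left_mult_one_mat[of _ n n] mult_carrier_mat[of _ n n])
next
  case (Cons x p)
  obtain c d where x: "x = (c, d)" by (cases x)
  have "S ^\<^sub>m c * T ^\<^sub>m d \<in> carrier_mat n n" "S ^\<^sub>m a * T ^\<^sub>m b \<in> carrier_mat n n"
    using assms by (auto intro!: mult_carrier_mat[of _ n n])
  then show ?case
    using assms unfolding x append_Cons eval_word.simps Cons.IH
    by (intro assoc_mult_mat[symmetric, of _ n n _ n _ n]) auto
qed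

lemma div_less_of_less_mult: "k < m * n \<Longrightarrow> k div n < (m :: nat)"
  by (rule less_mult_imp_div_less)

lemma mod_less_of_less_mult: "k < m * n \<Longrightarrow> k mod n < (n :: nat)"
  by (cases n) auto

text \<open>Groups the indices \<open>k = i * n + j\<close> into blocks of length \<open>n\<close>;
  this turns a sum over a Kronecker index into a double sum.\<close>

lemma sum_div_mod:
  fixes f :: "nat \<Rightarrow> nat \<Rightarrow> 'a :: comm_monoid_add"
  shows "(\<Sum>k<m * n. f (k div n) (k mod n)) = (\<Sum>i<m. \<Sum>j<n. f i j)"
proof -
  have "(\<Sum>k<m * n. f (k div n) (k mod n)) = (\<Sum>i<m. \<Sum>k = i * n..<i * n + n. f (k div n) (k mod n))"
    by (simp add: sum.nat_group)
  also have "\<dots> = (\<Sum>i<m. \<Sum>j<n. f i j)"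
  proof (rule sum.cong[OF refl])
    fix i
    have "(\<Sum>k = i * n..<i * n + n. f (k div n) (k mod n)) = (\<Sum>j = 0..<n. f ((j + i * n) div n) ((j + i * n) mod n))"
      using sum.shift_bounds_nat_ivl[of "\<lambda>k. f (k div n) (k mod n)" 0 "i * n" n] by (simp add: add.commute)
    also have "\<dots> = (\<Sum>j<n. f i j)"
      by (intro sum.cong) auto
    finally show "(\<Sum>k = i * n..<i * n + n. f (k div n) (k mod n)) = (\<Sum>j<n. f i j)" .
  qed
  finally show ?thesis .
qed

text \<open>The Kronecker product of an \<open>m \<times> m\<close> and an
  \<open>n \<times> n\<close> matrix, with the same block indexing as
  \<open>kms_mat\<close>.\<close>

definition kron :: "nat \<Rightarrow> nat \<Rightarrow> complex mat \<Rightarrow> complex mat \<Rightarrow> complex mat" where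
  "kron m n M A = Matrix.mat (m * n) (m * n)
     (\<lambda>(r, c). M $$ (r div n, c div n) * A $$ (r mod n, c mod n))"

lemma kron_carrier [simp]: "kron m n M A \<in> carrier_mat (m * n) (m * n)"
  and kron_dim [simp]: "dim_row (kron m n M A) = m * n"
  by (simp_all add: kron_def)

lemma kron_index:
  "r < m * n \<Longrightarrow> c < m * n \<Longrightarrow>
    kron m n M A $$ (r, c) = M $$ (r div n, c div n) * A $$ (r mod n, c mod n)"
  by (simp add: kron_def)

lemma kron_mult:
  assumes "M \<in> carrier_mat m m" "M' \<in> carrier_mat m m" "A \<in> carrier_mat n n" "A' \<in> carrier_mat n n"
  shows "kron m n M A * kron m n M' A' = kron m n (M * M') (A * A')"
proof (rule eq_matI)
  fix r c assume "r < dim_row (kron m n (M * M') (A * A'))" "c < dim_col (kron m n (M * M') (A * A'))"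
  then have rc: "r < m * n" "c < m * n" by (auto simp: kron_def)
  note dm = rc[THEN div_less_of_less_mult] rc[THEN mod_less_of_less_mult]
  have "(kron m n M A * kron m n M' A') $$ (r, c) =
      (\<Sum>k<m * n. (M $$ (r div n, k div n) * A $$ (r mod n, k mod n)) *
        (M' $$ (k div n, c div n) * A' $$ (k mod n, c mod n)))"
    using rc by (simp add: index_mult_sum[OF kron_carrier kron_carrier] kron_index)
  also have "\<dots> = (\<Sum>i<m. \<Sum>j<n. (M $$ (r div n, i) * A $$ (r mod n, j)) *
        (M' $$ (i, c div n) * A' $$ (j, c mod n)))"
    by (rule sum_div_mod)
  also have "\<dots> = (M * M') $$ (r div n, c div n) * (A * A') $$ (r mod n, c mod n)"
    unfolding index_mult_sum[OF assms(1,2) dm(1,2)] index_mult_sum[OF assms(3,4) dm(3,4)] sum_product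
    by (simp add: mult_ac)
  also have "\<dots> = kron m n (M * M') (A * A') $$ (r, c)"
    using rc by (simp add: kron_index)
  finally show "(kron m n M A * kron m n M' A') $$ (r, c) = kron m n (M * M') (A * A') $$ (r, c)" .
qed (auto simp: kron_def)

lemma kron_one: "kron m n (1\<^sub>m m) (1\<^sub>m n) = 1\<^sub>m (m * n)"
proof (rule eq_matI)
  fix r c assume "r < dim_row (1\<^sub>m (m * n) :: complex mat)" "c < dim_col (1\<^sub>m (m * n) :: complex mat)"
  then have rc: "r < m * n" "c < m * n" by auto
  note dm = rc[THEN div_less_of_less_mult] rc[THEN mod_less_of_less_mult]
  have "r = c \<longleftrightarrow> r div n = c div n \<and> r mod n = c mod n"
    by (metis div_mult_mod_eq)
  then show "kron m n (1\<^sub>m m) (1\<^sub>m n) $$ (r, c) = 1\<^sub>m (m * n) $$ (r, c)"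
    using rc dm by (auto simp: kron_index)
qed (auto simp: kron_def)

lemma kron_pow:
  assumes "M \<in> carrier_mat m m" "A \<in> carrier_mat n n"
  shows "kron m n M A ^\<^sub>m k = kron m n (M ^\<^sub>m k) (A ^\<^sub>m k)"
proof (induction k)
  case 0
  then show ?case using assms kron_one by simp
qed (use assms in \<open>auto simp: kron_mult\<close>)

lemma mat_adjoint_kron:
  assumes "M \<in> carrier_mat m m" "A \<in> carrier_mat n n"
  shows "mat_adjoint (kron m n M A) = kron m n (mat_adjoint M) (mat_adjoint A)"
proof (rule eq_matI)
  fix r c assume "r < dim_row (kron m n (mat_adjoint M) (mat_adjoint A))"
    "c < dim_col (kron m n (mat_adjoint M) (mat_adjoint A))"
  then have rc: "r < m * n" "c < m * n" by (auto simp: kron_def)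
  note dm = rc[THEN div_less_of_less_mult] rc[THEN mod_less_of_less_mult]
  show "mat_adjoint (kron m n M A) $$ (r, c) = kron m n (mat_adjoint M) (mat_adjoint A) $$ (r, c)"
    using rc dm assms
    by (simp add: mat_adjoint_index[OF kron_carrier] mat_adjoint_index[OF assms(1)]
        mat_adjoint_index[OF assms(2)] kron_index)
qed (auto simp: kron_def mat_adjoint_def)

lemma mat_trace_kron:
  assumes "M \<in> carrier_mat m m" "A \<in> carrier_mat n n"
  shows "mat_trace (kron m n M A) = mat_trace M * mat_trace A"
proof -
  have "mat_trace (kron m n M A) = (\<Sum>k<m * n. M $$ (k div n, k div n) * A $$ (k mod n, k mod n))"
    by (simp add: mat_trace_def kron_index)
  also have "\<dots> = mat_trace M * mat_trace A"
    using assms by (simp add: sum_div_mod[of "\<lambda>i j. M $$ (i, i) * A $$ (j, j)"] mat_trace_carrier sum_product)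
  finally show ?thesis .
qed

lemma eval_word_kron:
  assumes "M \<in> carrier_mat m m" "M' \<in> carrier_mat m m" "A \<in> carrier_mat n n" "A' \<in> carrier_mat n n"
  shows "eval_word p (kron m n M A) (kron m n M' A') = kron m n (eval_word p M M') (eval_word p A A')"
proof (induction p)
  case Nil
  then show ?case using assms kron_one by simp
next
  case (Cons x p)
  obtain a b where x: "x = (a, b)" by (cases x)
  have "M ^\<^sub>m a * M' ^\<^sub>m b \<in> carrier_mat m m" "A ^\<^sub>m a * A' ^\<^sub>m b \<in> carrier_mat n n"
    using assms by (auto intro!: mult_carrier_mat[of _ m m] mult_carrier_mat[of _ n n])
  then show ?case
    using assms Cons by (simp add: x kron_pow kron_mult)
qed

section \<open>The KMS matrix as the sum of the powers of a Kronecker product\<close>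

lemma kms_mat_carrier: "A \<in> carrier_mat n n \<Longrightarrow> kms_mat m A \<in> carrier_mat (m * n) (m * n)"
  by (auto simp: kms_mat_def Let_def)

lemma kms_mat_index:
  "A \<in> carrier_mat n n \<Longrightarrow> r < m * n \<Longrightarrow> c < m * n \<Longrightarrow>
    kms_mat m A $$ (r, c) = (if r div n < c div n
       then (A ^\<^sub>m (c div n - r div n)) $$ (r mod n, c mod n) else 0)"
  by (auto simp: kms_mat_def Let_def)

text \<open>The Jordan block shifts block rows or columns by one, so either product with
  \<open>X\<close> reproduces the blocks \<open>A ^\<^sub>m (C - R)\<close> with
  \<open>Suc R < C\<close>. The blocks with \<open>Suc R = C\<close> are those of
  \<open>X\<close>.\<close>

lemma kms_mat_eq:
  fixes m :: nat
  assumes A: "A \<in> carrier_mat n n"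
  defines "X \<equiv> kron m n (jordan_block m 0) A"
  shows "kms_mat m A = X + X * kms_mat m A" (is ?left) and "kms_mat m A = X + kms_mat m A * X" (is ?right)
proof -
  let ?K = "kms_mat m A"
  let ?J = "jordan_block m (0 :: complex)"
  have X: "X \<in> carrier_mat (m * n) (m * n)" by (simp add: X_def)
  note K = kms_mat_carrier[OF A, of m]
  have entries: "?K $$ (r, c) = (X + X * ?K) $$ (r, c)" "?K $$ (r, c) = (X + ?K * X) $$ (r, c)"
    if rc: "r < m * n" "c < m * n" for r c
  proof -
    define R C r' c' where RC: "R = r div n" "C = c div n" "r' = r mod n" "c' = c mod n"
    have lt: "R < m" "C < m" "r' < n" "c' < n"
      using rc by (auto simp: RC div_less_of_less_mult mod_less_of_less_mult)
    have Xrc: "X $$ (r, c) = (if Suc R = C then A $$ (r', c') else 0)"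
      using lt rc by (simp add: X_def kron_index flip: RC)
    have Krc: "?K $$ (r, c) = (if R < C then (A ^\<^sub>m (C - R)) $$ (r', c') else 0)"
      using kms_mat_index[OF A rc] by (simp flip: RC)
    have Apow: "(A ^\<^sub>m Suc k) $$ (r', c') = (\<Sum>t<n. A $$ (r', t) * (A ^\<^sub>m k) $$ (t, c'))"
      "(A ^\<^sub>m Suc k) $$ (r', c') = (\<Sum>t<n. (A ^\<^sub>m k) $$ (r', t) * A $$ (t, c'))" for k
      using index_mult_sum[OF A pow_carrier_mat[OF A] lt(3,4)]
        index_mult_sum[OF pow_carrier_mat[OF A] A lt(3,4)]
      by (simp_all only: pow_mat_Suc_left[OF A, symmetric] pow_mat.simps(2)[symmetric])
    have "(X * ?K) $$ (r, c) = (\<Sum>k<m * n. (?J $$ (R, k div n) * A $$ (r', k mod n)) *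
        (if k div n < C then (A ^\<^sub>m (C - k div n)) $$ (k mod n, c') else 0))"
      unfolding index_mult_sum[OF X K rc] using rc
      by (intro sum.cong) (simp_all add: X_def kron_index kms_mat_index[OF A] del: jordan_block_index flip: RC)
    also have "\<dots> = (\<Sum>S<m. \<Sum>t<n. (?J $$ (R, S) * A $$ (r', t)) * (if S < C then (A ^\<^sub>m (C - S)) $$ (t, c') else 0))"
      by (rule sum_div_mod)
    also have "\<dots> = (\<Sum>S<m. if S = Suc R then if Suc R < C then
        \<Sum>t<n. A $$ (r', t) * (A ^\<^sub>m (C - Suc R)) $$ (t, c') else 0 else 0)"
      using lt by (intro sum.cong) auto
    also have "\<dots> = (if Suc R < C then \<Sum>t<n. A $$ (r', t) * (A ^\<^sub>m (C - Suc R)) $$ (t, c') else 0)"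
      using lt by auto
    also have "\<dots> = (if Suc R < C then (A ^\<^sub>m (C - R)) $$ (r', c') else 0)"
      using Apow(1)[of "C - Suc R"] by (auto simp: Suc_diff_Suc simp del: pow_mat.simps)
    finally have XK: "(X * ?K) $$ (r, c) = (if Suc R < C then (A ^\<^sub>m (C - R)) $$ (r', c') else 0)" .
    have "(?K * X) $$ (r, c) = (\<Sum>k<m * n. (if R < k div n then (A ^\<^sub>m (k div n - R)) $$ (r', k mod n) else 0) *
        (?J $$ (k div n, C) * A $$ (k mod n, c')))"
      unfolding index_mult_sum[OF K X rc] using rc
      by (intro sum.cong) (simp_all add: X_def kron_index kms_mat_index[OF A] del: jordan_block_index flip: RC)
    also have "\<dots> = (\<Sum>S<m. \<Sum>t<n. (if R < S then (A ^\<^sub>m (S - R)) $$ (r', t) else 0) * (?J $$ (S, C) * A $$ (t, c')))"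
      by (rule sum_div_mod)
    \<comment> \<open>For \<open>C = 0\<close> truncated subtraction selects \<open>S = 0\<close>,
      which is harmless because \<open>Suc R < C\<close> then fails.\<close>
    also have "\<dots> = (\<Sum>S<m. if S = C - 1 then if Suc R < C then
        \<Sum>t<n. (A ^\<^sub>m (C - Suc R)) $$ (r', t) * A $$ (t, c') else 0 else 0)"
      using lt by (intro sum.cong) (auto simp: less_diff_conv)
    also have "\<dots> = (if Suc R < C then \<Sum>t<n. (A ^\<^sub>m (C - Suc R)) $$ (r', t) * A $$ (t, c') else 0)"
      using lt by auto
    also have "\<dots> = (if Suc R < C then (A ^\<^sub>m (C - R)) $$ (r', c') else 0)"
      using Apow(2)[of "C - Suc R"] by (auto simp: Suc_diff_Suc simp del: pow_mat.simps)
    finally have KX: "(?K * X) $$ (r, c) = (if Suc R < C then (A ^\<^sub>m (C - R)) $$ (r', c') else 0)" .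
    have "A ^\<^sub>m Suc 0 = A" using A by simp
    then have "?K $$ (r, c) = X $$ (r, c) + (if Suc R < C then (A ^\<^sub>m (C - R)) $$ (r', c') else 0)"
      unfolding Krc Xrc by (cases "Suc R < C"; cases "Suc R = C") auto
    then show "?K $$ (r, c) = (X + X * ?K) $$ (r, c)" "?K $$ (r, c) = (X + ?K * X) $$ (r, c)"
      using XK KX X K rc by auto
  qed
  show ?left ?right
    using entries X K by (intro eq_matI; auto)+
qed


subsection \<open>Unitary similarity and traces of words\<close>

text \<open>Carries \<open>N \<times> N\<close> matrices bijectively onto \<open>supp N\<close>, so
  that ring reasoning replaces carrier side conditions.\<close>

lift_definition fm :: "complex mat \<Rightarrow> fmat"
  is "\<lambda>A i j. if i < dim_row A \<and> j < dim_col A then A $$ (i, j) else 0"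
  by (metis (no_types, lifting) max.cobounded1 max.cobounded2 le_trans not_le)

lemmas ent_fm = fm.rep_eq

lemma supp_fm: "A \<in> carrier_mat N N \<Longrightarrow> supp N (fm A)"
  by (auto simp: supp_def ent_fm)

lemma fm_inj:
  assumes A: "A \<in> carrier_mat N N" and B: "B \<in> carrier_mat N N" and eq: "fm A = fm B"
  shows "A = B"
proof (rule eq_matI)
  fix i j assume "i < dim_row B" "j < dim_col B"
  moreover have "ent (fm A) i j = ent (fm B) i j" by (simp only: eq)
  ultimately show "A $$ (i, j) = B $$ (i, j)" using A B by (simp add: ent_fm)
qed (use A B in auto)

lemma fm_mult: "A \<in> carrier_mat N N \<Longrightarrow> B \<in> carrier_mat N N \<Longrightarrow> fm (A * B) = fm A * fm B"
proof (rule fmat_eqI)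
  fix i j assume A: "A \<in> carrier_mat N N" and B: "B \<in> carrier_mat N N"
  show "ent (fm (A * B)) i j = ent (fm A * fm B) i j"
  proof (cases "i < N \<and> j < N")
    case True
    then show ?thesis
      using A B index_mult_sum[OF A B, of i j] by (simp add: ent_times[OF supp_fm[OF A]] ent_fm)
  next
    case False
    then have "ent (fm (A * B)) i j = 0" "ent (fm A * fm B) i j = 0"
      using A B by (auto intro!: suppD[of N] supp_fm supp_times simp: not_less)
    then show ?thesis by simp
  qed
qed

lemma fm_add: "A \<in> carrier_mat N N \<Longrightarrow> B \<in> carrier_mat N N \<Longrightarrow> fm (A + B) = fm A + fm B"
  by (rule fmat_eqI) (auto simp: ent_fm ent_plus)

lemma fm_one: "fm (1\<^sub>m N) = idm N"
  by (rule fmat_eqI) (auto simp: ent_fm ent_idm)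

lemma fm_adjoint: "A \<in> carrier_mat N N \<Longrightarrow> fm (mat_adjoint A) = adj (fm A)"
  by (rule fmat_eqI) (auto simp: ent_fm ent_adj mat_adjoint_index carrier_matD[OF mat_adjoint_carrier])

lemma tr_fm: "A \<in> carrier_mat N N \<Longrightarrow> tr (fm A) = mat_trace A"
  by (simp add: tr_supp[OF supp_fm] mat_trace_carrier ent_fm)

lemma fm_surj:
  assumes "supp N a"
  obtains A where "A \<in> carrier_mat N N" "fm A = a"
proof
  show "fm (Matrix.mat N N (\<lambda>(i, j). ent a i j)) = a"
    using assms by (intro fmat_eqI) (auto simp: ent_fm supp_def not_less)
qed simp

text \<open>Multiplying \<open>X = mat_adjoint U * Y * U\<close> by \<open>U\<close> on the left
  gives an intertwining relation, the form needed for Specht's theorem and for exchanging KMS and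
  Kronecker matrices.\<close>

lemma unitarily_similar_iff:
  assumes X: "X \<in> carrier_mat N N" and Y: "Y \<in> carrier_mat N N"
  shows "unitarily_similar X Y \<longleftrightarrow>
    (\<exists>u. supp N u \<and> adj u * u = idm N \<and> u * adj u = idm N \<and> u * fm X = fm Y * u)"
proof
  assume "unitarily_similar X Y"
  then obtain U where U: "U \<in> carrier_mat N N" "unitary_mat U" "X = mat_adjoint U * Y * U"
    using X by (auto simp: unitarily_similar_def)
  have U': "mat_adjoint U \<in> carrier_mat N N" using U(1) by simp
  have "adj (fm U) * fm U = idm N" and UU: "fm U * adj (fm U) = idm N"
    using U by (auto simp: unitary_mat_def simp flip: fm_adjoint fm_mult[OF U' U(1)] fm_mult[OF U(1) U'] fm_one)
  moreover have "fm U * fm X = fm Y * fm U"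
  proof -
    have "fm X = adj (fm U) * fm Y * fm U"
      using U(1) U' Y unfolding U(3)
      by (simp add: fm_mult[of _ N] mult_carrier_mat[of _ N N] fm_adjoint)
    then have "fm U * fm X = fm U * adj (fm U) * (fm Y * fm U)"
      by (simp add: mult.assoc)
    then show ?thesis
      using UU supp_times[OF supp_fm[OF Y] supp_fm[OF U(1)]] by simp
  qed
  ultimately show "\<exists>u. supp N u \<and> adj u * u = idm N \<and> u * adj u = idm N \<and> u * fm X = fm Y * u"
    using supp_fm[OF U(1)] by blast
next
  assume "\<exists>u. supp N u \<and> adj u * u = idm N \<and> u * adj u = idm N \<and> u * fm X = fm Y * u"
  then obtain u where u: "supp N u" "adj u * u = idm N" "u * adj u = idm N" "u * fm X = fm Y * u"
    by blast
  obtain U where U: "U \<in> carrier_mat N N" "fm U = u" using fm_surj[OF u(1)] by blast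
  have U': "mat_adjoint U \<in> carrier_mat N N" using U(1) by simp
  have fm_prods: "fm (mat_adjoint U * U) = fm (1\<^sub>m N)" "fm (U * mat_adjoint U) = fm (1\<^sub>m N)"
    using u U U' by (simp_all add: fm_mult[of _ N] fm_one fm_adjoint)
  have "unitary_mat U"
    unfolding unitary_mat_def
  proof (intro conjI)
    show "mat_adjoint U * U = 1\<^sub>m (dim_row U)"
      using fm_inj[OF _ _ fm_prods(1), of N] U(1) U' by auto
    show "U * mat_adjoint U = 1\<^sub>m (dim_row U)"
      using fm_inj[OF _ _ fm_prods(2), of N] U(1) U' by auto
  qed (use U(1) in auto)
  moreover have "X = mat_adjoint U * Y * U"
  proof (rule fm_inj[OF X])
    show "mat_adjoint U * Y * U \<in> carrier_mat N N" using U(1) U' Y by (intro mult_carrier_mat)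
    have "fm X = adj u * u * fm X" using u(2) supp_fm[OF X] by simp
    also have "\<dots> = adj u * fm Y * u" using u(4) by (simp add: mult.assoc)
    also have "\<dots> = fm (mat_adjoint U * Y * U)"
      using U U' Y by (simp add: fm_mult[of _ N] mult_carrier_mat[of _ N N] fm_adjoint)
    finally show "fm X = fm (mat_adjoint U * Y * U)" .
  qed
  ultimately show "unitarily_similar X Y"
    unfolding unitarily_similar_def using X Y U(1) by blast
qed

text \<open>With \<open>k = x + x\<^sup>2 + \<dots>\<close>, that is \<open>(1 - x) (1 + k) = 1\<close>, each of \<open>x\<close> and \<open>k\<close> determines the other;
  the equations are stated without unit.\<close>

lemma quasi_inverse_intertwine:
  fixes x k x' k' u :: "'a :: ring"
  assumes "k = x + x * k" "k = x + k * x" "k' = x' + x' * k'" "k' = x' + k' * x'"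
  shows "u * k = k' * u \<longleftrightarrow> u * x = x' * u"
proof
  assume uk: "u * k = k' * u"
  define d where "d = u * x - x' * u"
  have "u * k = u * x + u * x * k"
    using arg_cong[OF assms(1), of "\<lambda>y. u * y"] by (simp add: distrib_left mult.assoc)
  moreover have "k' * u = x' * u + x' * u * k"
    using arg_cong[OF assms(3), of "\<lambda>y. y * u"] uk by (simp add: distrib_right mult.assoc)
  moreover have "d + d * k = (u * x + u * x * k) - (x' * u + x' * u * k)"
    by (simp add: d_def algebra_simps)
  ultimately have d: "d + d * k = 0"
    using uk by simp
  \<comment> \<open>The relation \<open>d + d * k = 0\<close> reads \<open>d (1 + k) = 0\<close>;
    this rearrangement stands in for right multiplication by the inverse
    \<open>1 - x\<close>.\<close>
  have "d = d + d * k - d * (x + k * x) + d * k * x + d * x - d * k"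
    by (simp add: algebra_simps)
  also have "\<dots> = (d + d * k) - d * k + (d + d * k) * x - d * k"
    using arg_cong[OF assms(2), of "\<lambda>y. d * y"] by (simp add: algebra_simps)
  finally have "d = - (d * k) - d * k" using d by simp
  then have "d = 0" using d by (simp add: add_eq_0_iff)
  then show "u * x = x' * u" by (simp add: d_def)
next
  assume ux: "u * x = x' * u"
  define d where "d = u * k - k' * u"
  have "u * k = u * x + x' * u * k"
    using arg_cong[OF assms(1), of "\<lambda>y. u * y"] ux by (simp add: distrib_left flip: mult.assoc)
  moreover have "k' * u = x' * u + x' * k' * u"
    using arg_cong[OF assms(3), of "\<lambda>y. y * u"] by (simp add: distrib_right mult.assoc)
  moreover have "x' * d = (x' * u + x' * u * k) - (x' * u + x' * k' * u)"
    by (simp add: d_def algebra_simps)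
  ultimately have d: "d = x' * d"
    using ux by (simp add: d_def)
  \<comment> \<open>Likewise \<open>(1 - x') d = 0\<close> is multiplied by \<open>1 + k'\<close> on
    the left.\<close>
  have "k' * d = x' * d + k' * (x' * d)"
    using arg_cong[OF assms(4), of "\<lambda>y. y * d"] by (simp add: distrib_right mult.assoc)
  then have "x' * d = 0" using d by simp
  then show "u * k = k' * u" using d by (simp add: d_def)
qed

text \<open>The same unitary serves both sides: \<open>quasi_inverse_intertwine\<close> exchanges
  the two intertwining relations and leaves the unitarity conditions alone.\<close>

lemma unitarily_similar_kms_mat_iff:
  assumes A: "A \<in> carrier_mat n n" and B: "B \<in> carrier_mat n n"
  shows "unitarily_similar (kms_mat m A) (kms_mat m B) \<longleftrightarrow>
    unitarily_similar (kron m n (jordan_block m 0) A) (kron m n (jordan_block m 0) B)"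
proof -
  have eqs: "fm (kms_mat m C) = fm (kron m n (jordan_block m 0) C) + fm (kron m n (jordan_block m 0) C) * fm (kms_mat m C)"
    "fm (kms_mat m C) = fm (kron m n (jordan_block m 0) C) + fm (kms_mat m C) * fm (kron m n (jordan_block m 0) C)"
    if C: "C \<in> carrier_mat n n" for C
  proof -
    let ?K = "kms_mat m C" and ?X = "kron m n (jordan_block m 0) C"
    have K: "?K \<in> carrier_mat (m * n) (m * n)" and X: "?X \<in> carrier_mat (m * n) (m * n)"
      using kms_mat_carrier[OF C] by simp_all
    have "fm (?X + ?X * ?K) = fm ?X + fm ?X * fm ?K" "fm (?X + ?K * ?X) = fm ?X + fm ?K * fm ?X"
      using fm_add[OF X mult_carrier_mat[OF X K]] fm_add[OF X mult_carrier_mat[OF K X]]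
      by (simp_all add: fm_mult[OF X K] fm_mult[OF K X])
    then show "fm ?K = fm ?X + fm ?X * fm ?K" "fm ?K = fm ?X + fm ?K * fm ?X"
      using kms_mat_eq[OF C, of m] by metis+
  qed
  show ?thesis
    unfolding unitarily_similar_iff[OF kms_mat_carrier[OF A] kms_mat_carrier[OF B]]
      unitarily_similar_iff[OF kron_carrier kron_carrier]
      quasi_inverse_intertwine[OF eqs[OF A] eqs[OF B]] ..
qed

lemma walg_word:
  assumes X: "X \<in> carrier_mat N N" and Y: "Y \<in> carrier_mat N N"
  shows "walg N (fm X) (fm Y) (fm (eval_word p X (mat_adjoint X))) (fm (eval_word p Y (mat_adjoint Y)))"
proof (induction p)
  case Nil
  then show ?case using X Y by (simp add: fm_one walg.one)
next
  case (Cons q p)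
  obtain c d where q: "q = (c, d)" by (cases q)
  have X': "mat_adjoint X \<in> carrier_mat N N" and Y': "mat_adjoint Y \<in> carrier_mat N N"
    using X Y by auto
  let ?w = "walg N (fm X) (fm Y)"
  \<comment> \<open>General in \<open>a\<close> and \<open>b\<close>, because
    \<open>X ^\<^sub>m Suc k\<close> ends in a factor \<open>X\<close> that is absorbed into the
    tail.\<close>
  have pow: "?w (fm (X ^\<^sub>m k) * a) (fm (Y ^\<^sub>m k) * b)" if "?w a b" for a b k
    using that
  proof (induction k arbitrary: a b)
    case 0
    then show ?case using X Y walg_supp[OF 0 supp_fm supp_fm, OF X Y] by (simp add: fm_one)
  next
    case (Suc k)
    then show ?case
      using Suc.IH[OF walg.mult[OF Suc.prems]] X Y
      by (simp add: fm_mult[of _ N] mult.assoc)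
  qed
  have pow': "?w (fm (mat_adjoint X ^\<^sub>m k) * a) (fm (mat_adjoint Y ^\<^sub>m k) * b)" if "?w a b" for a b k
    using that
  proof (induction k arbitrary: a b)
    case 0
    then show ?case using X' Y' walg_supp[OF 0 supp_fm supp_fm, OF X Y] by (simp add: fm_one)
  next
    case (Suc k)
    then show ?case
      using Suc.IH[OF walg.mult_adj[OF Suc.prems]] X' Y' X Y
      by (simp add: fm_mult[of _ N] fm_adjoint mult.assoc)
  qed
  show ?case
    using pow[OF pow'[OF Cons.IH], of c d] X Y X' Y'
    by (simp add: q fm_mult[of _ N] mult_carrier_mat[of _ N N] mult.assoc)
qed

text \<open>Specht's theorem. Forwards, the unitary intertwines the values of every word; backwards,
  equality of traces extends from words to all of \<open>walg\<close>, and
  \<open>unitary_intertwiner\<close> applies.\<close>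

theorem unitarily_similar_iff_traces:
  assumes X: "X \<in> carrier_mat N N" and Y: "Y \<in> carrier_mat N N"
  shows "unitarily_similar X Y \<longleftrightarrow>
    (\<forall>p. mat_trace (eval_word p X (mat_adjoint X)) = mat_trace (eval_word p Y (mat_adjoint Y)))"
proof
  assume "unitarily_similar X Y"
  then obtain u where u: "supp N u" "adj u * u = idm N" "u * adj u = idm N" "u * fm X = fm Y * u"
    using unitarily_similar_iff[OF X Y] by blast
  note sX = supp_fm[OF X] and sY = supp_fm[OF Y]
  have "u * adj (fm X) = adj (fm Y) * u"
  proof -
    have "fm X * adj u = adj u * fm Y"
    proof -
      have "fm X * adj u = adj u * u * fm X * adj u" using u sX by simp
      also have "\<dots> = adj u * (u * fm X) * adj u" by (simp add: mult.assoc)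
      also have "\<dots> = adj u * fm Y * (u * adj u)" by (simp add: u(4) mult.assoc)
      also have "\<dots> = adj u * fm Y" using u(1,3) sY by (simp add: supp_times supp_adj)
      finally show ?thesis .
    qed
    from arg_cong[OF this, of adj] show ?thesis by simp
  qed
  note intertwine = walg_intertwine[OF walg_word[OF X Y] u(1) u(4) this]
  show "\<forall>p. mat_trace (eval_word p X (mat_adjoint X)) = mat_trace (eval_word p Y (mat_adjoint Y))"
  proof
    fix p
    let ?a = "eval_word p X (mat_adjoint X)" and ?b = "eval_word p Y (mat_adjoint Y)"
    have ab: "?a \<in> carrier_mat N N" "?b \<in> carrier_mat N N" using X Y by auto
    have "tr (fm ?a) = tr (adj u * (u * fm ?a))"
      using u(2) supp_fm[OF ab(1)] by (simp flip: mult.assoc)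
    also have "\<dots> = tr (fm ?b * (u * adj u))"
      unfolding intertwine by (subst tr_commute) (simp add: mult.assoc)
    also have "\<dots> = tr (fm ?b)"
      using u(3) supp_fm[OF ab(2)] by simp
    finally show "mat_trace ?a = mat_trace ?b" by (simp add: tr_fm[OF ab(1)] tr_fm[OF ab(2)])
  qed
next
  assume traces: "\<forall>p. mat_trace (eval_word p X (mat_adjoint X)) = mat_trace (eval_word p Y (mat_adjoint Y))"
  have X': "mat_adjoint X \<in> carrier_mat N N" and Y': "mat_adjoint Y \<in> carrier_mat N N"
    using X Y by auto
  let ?x = "\<lambda>p. eval_word p X (mat_adjoint X)" and ?y = "\<lambda>p. eval_word p Y (mat_adjoint Y)"
  have ev: "?x p \<in> carrier_mat N N" "?y p \<in> carrier_mat N N" for p using X Y by auto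
  have append: "fm (?x (p @ [(1, 0)])) = fm (?x p) * fm X" "fm (?y (p @ [(1, 0)])) = fm (?y p) * fm Y"
    "fm (?x (p @ [(0, 1)])) = fm (?x p) * adj (fm X)" "fm (?y (p @ [(0, 1)])) = fm (?y p) * adj (fm Y)" for p
    using X Y
    by (simp_all add: eval_word_snoc[of _ N] fm_mult[of _ N] fm_adjoint carrier_matD[OF X'] carrier_matD[OF Y']
        left_mult_one_mat[OF X'] left_mult_one_mat[OF Y'] right_mult_one_mat[OF X] right_mult_one_mat[OF Y])
  \<comment> \<open>The arbitrary prefix \<open>p\<close> drives the induction: a leading
    \<open>X\<close> or \<open>adj X\<close> of the second factor moves to the end of the word as
    \<open>(1, 0)\<close> or \<open>(0, 1)\<close>.\<close>
  have words: "tr (fm (?x p) * a) = tr (fm (?y p) * b)" if "walg N (fm X) (fm Y) a b" for a b p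
    using that
  proof (induction arbitrary: p)
    case one
    then show ?case
      using traces supp_fm[OF ev(1)] supp_fm[OF ev(2)] by (simp add: tr_fm[OF ev(1)] tr_fm[OF ev(2)])
  next
    case (mult a b)
    show ?case using mult.IH[of "p @ [(1, 0)]"] by (simp only: append mult.assoc)
  next
    case (mult_adj a b)
    show ?case using mult_adj.IH[of "p @ [(0, 1)]"] by (simp only: append mult.assoc)
  qed (simp_all add: distrib_left)
  have "tr a = tr b" if w: "walg N (fm X) (fm Y) a b" for a b
    using words[OF w, of "[]"] walg_supp[OF w supp_fm supp_fm, OF X Y] X Y by (simp add: fm_one)
  then obtain u where "supp N u" "adj u * u = idm N" "u * adj u = idm N" "u * fm X = fm Y * u"
    using unitary_intertwiner[OF supp_fm[OF X] supp_fm[OF Y]] by blast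
  then show "unitarily_similar X Y"
    unfolding unitarily_similar_iff[OF X Y] by blast
qed

theorem theorem4p10:
  fixes m n :: nat and A B :: "complex mat"
  assumes "m \<ge> 2"
    and "A \<in> carrier_mat n n"
    and "B \<in> carrier_mat n n"
  shows "unitarily_similar (kms_mat m A) (kms_mat m B) \<longleftrightarrow>
    (\<forall>p :: word2.
       mat_trace (eval_word p (jordan_block m 0) (mat_adjoint (jordan_block m 0))) \<noteq> 0 \<longrightarrow>
       mat_trace (eval_word p A (mat_adjoint A)) = mat_trace (eval_word p B (mat_adjoint B)))"
proof -
  let ?J = "jordan_block m 0 :: complex mat"
  have J: "?J \<in> carrier_mat m m" by simp
  have "mat_trace (eval_word p (kron m n ?J C) (mat_adjoint (kron m n ?J C))) =
      mat_trace (eval_word p ?J (mat_adjoint ?J)) * mat_trace (eval_word p C (mat_adjoint C))"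
    if "C \<in> carrier_mat n n" for C p
    unfolding mat_adjoint_kron[OF J that]
      eval_word_kron[OF J mat_adjoint_carrier[OF J] that mat_adjoint_carrier[OF that]]
    using J that by (intro mat_trace_kron eval_word_carrier mat_adjoint_carrier)
  \<comment> \<open>A word whose trace at the Jordan block is 0 contributes \<open>0 = 0\<close>;
    for every other word the nonzero factor cancels.\<close>
  then show ?thesis
    unfolding unitarily_similar_kms_mat_iff[OF assms(2,3)] unitarily_similar_iff_traces[OF kron_carrier kron_carrier]
    using assms(2,3) by auto
qed

end
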